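(* Let $0<\lambda\le1$ and let $f,F\in\mathcal{F}_H^0(\lambda)$. Then: (a) $f*F\in\mathcal{F}_H^0(\lambda^2/2)$; (b) $f*F$ is starlike of order $2(2-\lambda^2)/(4+\lambda^2)$; and (c) $f*F$ is convex of order $2(1-\lambda^2)/(2+\lambda^2)$. Moreover, all these results are sharp: for each $\lambda\in(0,1]$, the parameter $\lambda^2/2$ in (a) cannot be replaced by any smaller positive number, and the orders in (b) and (c) cannot be replaced by any larger numbers.
   Context: $\mathbb{D}=\{z\in\mathbb{C}:|z|<1\}$. For $0<\lambda\le1$, $\mathcal{F}_H^0(\lambda)$ is the class of all complex-valued harmonic functions $f$ in $\mathbb{D}$ with $f(0)=0$, $f_z(0)=1$, $f_{\bar z}(0)=0$ and $|f_z(z)-1|<\lambda-|f_{\bar z}(z)|$ for all $z\in\mathbb{D}$. For $f(z)=z+\sum_{n\ge2}a_nz^n+\overline{\sum_{n\ge2}b_nz^n}$ and $F(z)=z+\sum_{n\ge2}A_nz^n+\overline{\sum_{n\ge2}B_nz^n}$, the harmonic convolution is $(f*F)(z)=z+\sum_{n\ge2}a_nA_nz^n+\overline{\sum_{n\ge2}b_nB_nz^n}$. For $0\le\alpha<1$, a harmonic function $f$ in $\mathbb{D}$ with $f(0)=0$, $f_z(0)=1$ is starlike of order $\alpha$ if $\frac{\partial}{\partial\theta}\arg f(re^{i\theta})>\alpha$ for all $0<r<1$, $0\le\theta\le2\pi$, and convex of order $\alpha$ if $\frac{\partial}{\partial\theta}\left(\arg\left\{\frac{\partial}{\partial\theta}f(re^{i\theta})\right\}\right)>\alpha$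 for all $0<r<1$, $0\le\theta\le2\pi$. *)

theory Defs
  imports "HOL-Analysis.Analysis"
begin

section \<open>Harmonic mappings of the unit disc\<close>

abbreviation unit_disc :: "complex set" where
  "unit_disc \<equiv> ball 0 1"

definition dx :: "(complex \<Rightarrow> complex) \<Rightarrow> complex \<Rightarrow> complex" where
  "dx f z = frechet_derivative f (at z) 1"

definition dy :: "(complex \<Rightarrow> complex) \<Rightarrow> complex \<Rightarrow> complex" where
  "dy f z = frechet_derivative f (at z) \<i>"

text \<open>Differentiability is real Frechet differentiability throughout. The first two
  conditions say that \<open>f\<close> is twice continuously (real) differentiable.\<close>

definition harmonic_on :: "(complex \<Rightarrow> complex) \<Rightarrow> complex set \<Rightarrow> bool" where
  "harmonic_on f S \<longleftrightarrow>
     (\<forall>z\<in>S. f differentiable (at z) \<and> dx f differentiable (at z) \<and> dy f differentiable (at z)) \<and>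
     continuous_on S (dx (dx f)) \<and> continuous_on S (dy (dx f)) \<and>
     continuous_on S (dx (dy f)) \<and> continuous_on S (dy (dy f)) \<and>
     (\<forall>z\<in>S. dx (dx f) z + dy (dy f) z = 0)"

text \<open>The Wirtinger derivatives \<open>f\<^sub>z\<close> and \<open>f\<^sub>z\<^sub>b\<^sub>a\<^sub>r\<close>.\<close>

definition dz :: "(complex \<Rightarrow> complex) \<Rightarrow> complex \<Rightarrow> complex" where
  "dz f z = (dx f z - \<i> * dy f z) / 2"

definition dzbar :: "(complex \<Rightarrow> complex) \<Rightarrow> complex \<Rightarrow> complex" where
  "dzbar f z = (dx f z + \<i> * dy f z) / 2"

definition FH0 :: "real \<Rightarrow> (complex \<Rightarrow> complex) set" where
  "FH0 lam = {f. harmonic_on f unit_disc \<and> f 0 = 0 \<and> dz f 0 = 1 \<and> dzbar f 0 = 0 \<and>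
                 (\<forall>z\<in>unit_disc. cmod (dz f z - 1) < lam - cmod (dzbar f z))}"

section \<open>Harmonic convolution\<close>

definition harmonic_series :: "(nat \<Rightarrow> complex) \<Rightarrow> (nat \<Rightarrow> complex) \<Rightarrow> complex \<Rightarrow> complex" where
  "harmonic_series a b z = (\<Sum>n. a n * z ^ n) + cnj (\<Sum>n. b n * z ^ n)"

text \<open>The expansion \<open>f(z) = z + (\<Sum>n\<ge>2. a\<^sub>n z\<^sup>n) + cnj (\<Sum>n\<ge>2. b\<^sub>n z\<^sup>n)\<close>; fixing the coefficients
  of index 0 and 1 makes the pair \<open>(a, b)\<close> unique.\<close>

definition harmonic_expansion ::
    "(complex \<Rightarrow> complex) \<Rightarrow> (nat \<Rightarrow> complex) \<Rightarrow> (nat \<Rightarrow> complex) \<Rightarrow> bool" where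
  "harmonic_expansion f a b \<longleftrightarrow>
     a 0 = 0 \<and> a 1 = 1 \<and> b 0 = 0 \<and> b 1 = 0 \<and>
     (\<forall>z\<in>unit_disc. summable (\<lambda>n. a n * z ^ n) \<and> summable (\<lambda>n. b n * z ^ n) \<and>
                    f z = harmonic_series a b z)"

definition harmonic_coeffs ::
    "(complex \<Rightarrow> complex) \<Rightarrow> (nat \<Rightarrow> complex) \<times> (nat \<Rightarrow> complex)" where
  "harmonic_coeffs f = (THE (a, b). harmonic_expansion f a b)"

definition hconv :: "(complex \<Rightarrow> complex) \<Rightarrow> (complex \<Rightarrow> complex) \<Rightarrow> complex \<Rightarrow> complex"
    (infixl "\<star>" 70) where
  "f \<star> F = (let (a, b) = harmonic_coeffs f; (A, B) = harmonic_coeffs F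
            in harmonic_series (\<lambda>n. a n * A n) (\<lambda>n. b n * B n))"

section \<open>Starlikeness and convexity of a given order\<close>

text \<open>\<open>has_arg_derivative c d t\<close>: the derivative of \<open>arg (c s)\<close> at \<open>s = t\<close> is \<open>d\<close>. Here \<open>arg\<close>
  is a local branch of the argument along the curve \<open>c\<close> (not the principal value, which jumps);
  \<open>d\<close> does not depend on the branch. At a zero of \<open>c\<close> the argument is undefined.\<close>

definition has_arg_derivative :: "(real \<Rightarrow> complex) \<Rightarrow> real \<Rightarrow> real \<Rightarrow> bool" where
  "has_arg_derivative c d t \<longleftrightarrow>
     c t \<noteq> 0 \<and>
     (\<exists>\<phi>. (\<forall>\<^sub>F s in nhds t. c s = of_real (cmod (c s)) * cis (\<phi> s)) \<and>
          (\<phi> has_real_derivative d) (at t))"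

definition circle_curve :: "(complex \<Rightarrow> complex) \<Rightarrow> real \<Rightarrow> real \<Rightarrow> complex" where
  "circle_curve f r \<theta> = f (of_real r * cis \<theta>)"

definition circle_tangent :: "(complex \<Rightarrow> complex) \<Rightarrow> real \<Rightarrow> real \<Rightarrow> complex" where
  "circle_tangent f r \<theta> = vector_derivative (circle_curve f r) (at \<theta>)"

definition starlike_of_order :: "real \<Rightarrow> (complex \<Rightarrow> complex) \<Rightarrow> bool" where
  "starlike_of_order \<alpha> f \<longleftrightarrow>
     harmonic_on f unit_disc \<and> f 0 = 0 \<and> dz f 0 = 1 \<and>
     (\<forall>r \<theta>. 0 < r \<and> r < 1 \<and> 0 \<le> \<theta> \<and> \<theta> \<le> 2 * pi \<longrightarrow>
        (\<exists>d. has_arg_derivative (circle_curve f r) d \<theta> \<and> d > \<alpha>))"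

definition convex_of_order :: "real \<Rightarrow> (complex \<Rightarrow> complex) \<Rightarrow> bool" where
  "convex_of_order \<alpha> f \<longleftrightarrow>
     harmonic_on f unit_disc \<and> f 0 = 0 \<and> dz f 0 = 1 \<and>
     (\<forall>r \<theta>. 0 < r \<and> r < 1 \<and> 0 \<le> \<theta> \<and> \<theta> \<le> 2 * pi \<longrightarrow>
        (\<exists>d. has_arg_derivative (circle_tangent f r) d \<theta> \<and> d > \<alpha>))"

end

theory Submission
  imports Defs "HOL-Complex_Analysis.Cauchy_Integral_Formula"
begin

text \<open>
  Write \<open>f = h + cnj g\<close> with \<open>h, g\<close> holomorphic. Membership in the class says
  \<open>|h' - 1| + |g'| < \<lambda>\<close>, hence \<open>|h' - 1|\<^sup>2 + |g'|\<^sup>2 \<le> \<lambda>\<^sup>2\<close>, and averaging over circles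
  (\<open>bessel_power_sum_pair\<close>) gives \<open>\<Sum> n\<^sup>2 (|a\<^sub>n|\<^sup>2 + |b\<^sub>n|\<^sup>2) \<le> \<lambda>\<^sup>2\<close>, the sum being over \<open>n \<ge> 2\<close>.
  The coefficients \<open>c\<^sub>n, d\<^sub>n\<close> of a convolution are products, so the arithmetic-geometric mean
  inequality turns two such quadratic bounds into the linear bound
  \<open>\<Sum> n\<^sup>2 (|c\<^sub>n| + |d\<^sub>n|) \<le> \<lambda>\<^sup>2\<close>. All three assertions follow from this one inequality by comparing
  weights: \<open>n \<le> n\<^sup>2/2\<close> for the class with parameter \<open>\<lambda>\<^sup>2/2\<close>, and
  \<open>n + \<alpha> \<le> (1 - \<alpha>) n\<^sup>2 / \<lambda>\<^sup>2\<close> and \<open>n (n + \<beta>) \<le> (1 - \<beta>) n\<^sup>2 / \<lambda>\<^sup>2\<close> for the two orders. In each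
  comparison \<open>n = 2\<close> is the critical index and gives equality, which determines the constants.

  The argument of \<open>f(r e\<^sup>i\<^sup>t)\<close> has derivative \<open>Re (Df / f)\<close> with \<open>Df = z h' - cnj (z g')\<close>, and
  \<open>Re (Df / f) > \<alpha>\<close> amounts to \<open>|Df - f| < |Df + (1 - 2\<alpha>) f|\<close>, in which the term \<open>z\<close>
  dominates as soon as \<open>\<Sum> (n - \<alpha>) |c\<^sub>n| + (n + \<alpha>) |d\<^sub>n| \<le> 1 - \<alpha>\<close>
  (\<open>coefficient_condition_starlike\<close>). The tangent of the image curve is \<open>\<i> Df\<close>, so convexity of
  \<open>f\<close> is the same statement about the coefficients \<open>n c\<^sub>n, - n d\<^sub>n\<close> of \<open>Df\<close>.

  Sharpness comes from concentrating everything on \<open>n = 2\<close>: \<open>z + (\<lambda>/2) z\<^sup>2\<close> convolved with itself is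
  \<open>z + (\<lambda>\<^sup>2/4) z\<^sup>2\<close>, whose \<open>z\<close>-derivative minus one is \<open>\<lambda>\<^sup>2 z / 2\<close>; and \<open>z + (\<lambda>/2) cnj z\<^sup>2\<close> convolved with
  itself is \<open>z + (\<lambda>\<^sup>2/4) cnj z\<^sup>2\<close>, for which the two orders are approached at \<open>z \<rightarrow> 1\<close> and
  \<open>z \<rightarrow> -1\<close>.

  The definitions speak of twice continuously differentiable functions and of the expansion of
  such a function. That the expansion exists needs the classical structure theorem: \<open>f\<^sub>z\<close> and
  the conjugate of \<open>f\<^sub>z\<^sub>b\<^sub>a\<^sub>r\<close> satisfy the Cauchy-Riemann equations, because the Laplacian
  vanishes and mixed second derivatives commute, and their primitives are \<open>h\<close> and \<open>g\<close>. That the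
  expansion is unique holds because \<open>f\<^sub>z = h'\<close> determines \<open>a\<close> and \<open>f\<^sub>z\<^sub>b\<^sub>a\<^sub>r\<close> determines \<open>b\<close>.
\<close>

section \<open>The derivative of the argument along a curve\<close>

text \<open>For existence, near \<open>t\<close> the quotient \<open>c s / c t\<close> stays close to 1, where the principal
  logarithm is differentiable, and its imaginary part supplies the branch. For uniqueness, any
  branch \<open>\<phi>\<close> makes \<open>c s * cis (- \<phi> s)\<close> real, so its derivative has imaginary part zero.\<close>

lemma has_arg_derivative_iff:
  assumes c: "(c has_vector_derivative c') (at t)" and nz: "c t \<noteq> 0"
  shows "has_arg_derivative c d t \<longleftrightarrow> d = Im (c' / c t)"
proof
  assume "has_arg_derivative c d t"
  then obtain \<phi> where polar: "\<forall>\<^sub>F s in nhds t. c s = of_real (cmod (c s)) * cis (\<phi> s)"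
    and \<phi>: "(\<phi> has_real_derivative d) (at t)"
    unfolding has_arg_derivative_def by blast
  have "((\<lambda>s. - \<phi> s) has_derivative (\<lambda>h. - (d * h))) (at t)"
    using \<phi> by (auto simp: has_field_derivative_def intro!: derivative_eq_intros)
  from has_derivative_cis[OF this]
  have "((\<lambda>s. cis (- \<phi> s)) has_vector_derivative - d *\<^sub>R (\<i> * cis (- \<phi> t))) (at t)"
    unfolding has_vector_derivative_def by (simp add: algebra_simps scaleR_conv_of_real)
  with c have "((\<lambda>s. c s * cis (- \<phi> s)) has_vector_derivative
      (c t * (- d *\<^sub>R (\<i> * cis (- \<phi> t))) + c' * cis (- \<phi> t))) (at t)"
    by (rule has_vector_derivative_mult)
  then have "((\<lambda>s. Im (c s * cis (- \<phi> s))) has_vector_derivative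
      Im (c t * (- d *\<^sub>R (\<i> * cis (- \<phi> t))) + c' * cis (- \<phi> t))) (at t)"
    by (rule bounded_linear.has_vector_derivative[OF bounded_linear_Im])
  moreover have "\<forall>\<^sub>F s in nhds t. Im (c s * cis (- \<phi> s)) = 0"
    using polar
  proof eventually_elim
    case (elim s)
    have "c s * cis (- \<phi> s) = of_real (cmod (c s)) * (cis (\<phi> s) * cis (- \<phi> s))"
      using elim by (metis mult.assoc)
    then show ?case by (simp add: cis_mult)
  qed
  ultimately have "((\<lambda>s. 0 :: real) has_vector_derivative
      Im (c t * (- d *\<^sub>R (\<i> * cis (- \<phi> t))) + c' * cis (- \<phi> t))) (at t)"
    by (subst has_vector_derivative_cong_ev[where g = "\<lambda>s. Im (c s * cis (- \<phi> s))"])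
      (auto elim: eventually_mono dest: eventually_nhds_x_imp_x)
  then have "Im (c t * (- d *\<^sub>R (\<i> * cis (- \<phi> t))) + c' * cis (- \<phi> t)) = 0"
    using vector_derivative_at vector_derivative_const_at by metis
  moreover have "c t * (- d *\<^sub>R (\<i> * cis (- \<phi> t))) + c' * cis (- \<phi> t)
      = (c' / c t - d *\<^sub>R \<i>) * (c t * cis (- \<phi> t))"
    using nz by (simp add: field_simps scaleR_conv_of_real)
  moreover have "c t * cis (- \<phi> t) = of_real (cmod (c t))"
  proof -
    have "c t * cis (- \<phi> t) = of_real (cmod (c t)) * (cis (\<phi> t) * cis (- \<phi> t))"
      using eventually_nhds_x_imp_x[OF polar] by (metis mult.assoc)
    then show ?thesis by (simp add: cis_mult)
  qed
  ultimately have "Im ((c' / c t - d *\<^sub>R \<i>) * of_real (cmod (c t))) = 0" by metis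
  then show "d = Im (c' / c t)" using nz by (simp del: of_real_mult)
next
  assume d: "d = Im (c' / c t)"
  define \<phi> where "\<phi> s = Arg (c t) + Im (Ln (c s / c t))" for s
  have "c s = of_real (cmod (c s)) * cis (\<phi> s)" for s
  proof (cases "c s = 0")
    case False
    have quot: "c s / c t = of_real (cmod (c s / c t)) * cis (Im (Ln (c s / c t)))"
      using False nz by (metis divide_eq_0_iff exp_Ln exp_eq_polar Re_Ln exp_ln zero_less_norm_iff)
    have base: "c t = of_real (cmod (c t)) * cis (Arg (c t))"
      using nz by (metis rcis_cmod_Arg rcis_def)
    have "c s = c t * (c s / c t)" using nz by simp
    also have "\<dots> = (of_real (cmod (c t)) * cis (Arg (c t))) *
        (of_real (cmod (c s / c t)) * cis (Im (Ln (c s / c t))))"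
      by (rule arg_cong2[OF base quot])
    also have "\<dots> = of_real (cmod (c t) * cmod (c s / c t)) * cis (\<phi> s)"
      by (simp add: \<phi>_def mult_ac flip: cis_mult)
    also have "cmod (c t) * cmod (c s / c t) = cmod (c s)"
      using nz by (simp add: norm_divide)
    finally show ?thesis .
  qed simp
  moreover have "(\<phi> has_real_derivative d) (at t)"
  proof -
    have "((\<lambda>s. c s / c t) has_vector_derivative (c' / c t)) (at t)"
      using c by (rule has_vector_derivative_divide)
    moreover have "(Ln has_field_derivative 1) (at (c t / c t))"
      using nz has_field_derivative_Ln[of 1] by simp
    ultimately have "((Ln \<circ> (\<lambda>s. c s / c t)) has_vector_derivative (c' / c t * 1)) (at t)"
      by (rule field_vector_diff_chain_at)
    then have "((\<lambda>s. Im (Ln (c s / c t))) has_vector_derivative Im (c' / c t)) (at t)"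
      using bounded_linear.has_vector_derivative[OF bounded_linear_Im] by (fastforce simp: o_def)
    then show ?thesis unfolding \<phi>_def d has_real_derivative_iff_has_vector_derivative
      by (auto intro!: derivative_eq_intros)
  qed
  ultimately show "has_arg_derivative c d t"
    unfolding has_arg_derivative_def using nz by (intro conjI exI[of _ \<phi>]) auto
qed

section \<open>Sums of holomorphic and antiholomorphic functions\<close>

lemma holomorphic_plus_conj_derivative:
  assumes "open S" "z \<in> S" "\<And>w. w \<in> S \<Longrightarrow> f w = h w + cnj (g w)"
    and "(h has_field_derivative h') (at z)" "(g has_field_derivative g') (at z)"
  shows "(f has_derivative (\<lambda>v. h' * v + cnj (g' * v))) (at z)"
    and "dx f z = h' + cnj g'" and "dy f z = \<i> * h' + cnj (\<i> * g')"
    and "dz f z = h'" and "dzbar f z = cnj g'"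
proof -
  have "((\<lambda>w. h w + cnj (g w)) has_derivative (\<lambda>v. h' * v + cnj (g' * v))) (at z)"
    using assms(4,5) unfolding has_field_derivative_def
    by (auto intro!: derivative_eq_intros)
  then show f: "(f has_derivative (\<lambda>v. h' * v + cnj (g' * v))) (at z)"
    using assms(1-3) by (auto elim: has_derivative_transform_within_open)
  show *: "dx f z = h' + cnj g'" "dy f z = \<i> * h' + cnj (\<i> * g')"
    unfolding dx_def dy_def frechet_derivative_at[OF f, symmetric] by simp_all
  show "dz f z = h'" "dzbar f z = cnj g'"
    unfolding dz_def dzbar_def * by (simp_all add: algebra_simps)
qed

text \<open>The partial derivatives of \<open>h + cnj g\<close> are again of this form, for the pairs \<open>(h', g')\<close> and
  \<open>(\<i> h', \<i> g')\<close>; two steps of this kind reach all second derivatives, and \<open>\<i>\<^sup>2 = -1\<close> makes the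
  Laplacian vanish.\<close>

lemma harmonic_on_holomorphic_plus_conj:
  assumes S: "open S" and f: "\<And>w. w \<in> S \<Longrightarrow> f w = h w + cnj (g w)"
    and h: "h holomorphic_on S" and g: "g holomorphic_on S"
  shows "harmonic_on f S"
proof -
  have step: "(\<forall>w\<in>S. F differentiable at w) \<and>
      (\<forall>w\<in>S. dx F w = deriv H w + cnj (deriv G w)) \<and>
      (\<forall>w\<in>S. dy F w = \<i> * deriv H w + cnj (\<i> * deriv G w))"
    if "\<forall>w\<in>S. F w = H w + cnj (G w)" "H holomorphic_on S" "G holomorphic_on S" for F H G
  proof (intro conjI ballI)
    fix w assume w: "w \<in> S"
    have *: "(H has_field_derivative deriv H w) (at w)" "(G has_field_derivative deriv G w) (at w)"
      using that(2,3) S w by (simp_all add: holomorphic_derivI)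
    note D = holomorphic_plus_conj_derivative[OF S w _ *, of F]
    show "F differentiable at w" using D(1) that(1) by (auto simp: differentiable_def)
    show "dx F w = deriv H w + cnj (deriv G w)" using D(2) that(1) by auto
    show "dy F w = \<i> * deriv H w + cnj (\<i> * deriv G w)" using D(3) that(1) by auto
  qed
  have hol: "deriv F holomorphic_on S" "(\<lambda>w. \<i> * F w) holomorphic_on S"
    "(\<lambda>w. \<i> * deriv F w) holomorphic_on S" if "F holomorphic_on S" for F
    using that S by (auto intro!: holomorphic_intros holomorphic_deriv)
  have cont: "continuous_on S F" if "\<forall>w\<in>S. F w = H w + cnj (G w)"
    "H holomorphic_on S" "G holomorphic_on S" for F H G
  proof -
    have "continuous_on S (\<lambda>w. H w + cnj (G w))"
      using that(2,3) by (intro continuous_intros holomorphic_on_imp_continuous_on)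
    then show ?thesis using that(1) by (simp cong: continuous_on_cong)
  qed
  have f': "\<forall>w\<in>S. f w = h w + cnj (g w)" using f by blast
  note s0 = step[OF f' h g]
  note hx = hol(1)[OF h] and gx = hol(1)[OF g] and hy = hol(3)[OF h] and gy = hol(3)[OF g]
  note sx = step[OF conjunct1[OF conjunct2[OF s0]] hx gx]
  note sy = step[OF conjunct2[OF conjunct2[OF s0]] hy gy]
  have di: "deriv (\<lambda>w. \<i> * deriv F w) w = \<i> * deriv (deriv F) w"
    if "F holomorphic_on S" "w \<in> S" for F w
    using that S hol(1) by (intro deriv_cmult) (meson holomorphic_on_imp_differentiable_at)
  show ?thesis
    unfolding harmonic_on_def
  proof (intro conjI ballI)
    show "continuous_on S (dx (dx f))" by (rule cont[OF conjunct1[OF conjunct2[OF sx]] hol(1)[OF hx] hol(1)[OF gx]])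
    show "continuous_on S (dy (dx f))" by (rule cont[OF conjunct2[OF conjunct2[OF sx]] hol(3)[OF hx] hol(3)[OF gx]])
    show "continuous_on S (dx (dy f))" by (rule cont[OF conjunct1[OF conjunct2[OF sy]] hol(1)[OF hy] hol(1)[OF gy]])
    show "continuous_on S (dy (dy f))" by (rule cont[OF conjunct2[OF conjunct2[OF sy]] hol(3)[OF hy] hol(3)[OF gy]])
  next
    fix w assume w: "w \<in> S"
    show "f differentiable at w" "dx f differentiable at w" "dy f differentiable at w"
      using s0 sx sy w by blast+
    show "dx (dx f) w + dy (dy f) w = 0"
      using sx sy w by (simp add: di h g)
  qed
qed

section \<open>Commuting partial derivatives and the decomposition of harmonic functions\<close>

text \<open>The mean value theorem applies first to \<open>x \<mapsto> U x s - U x 0\<close> and then to \<open>Ux x\<close>. The left-hand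
  side is symmetric in the two variables, so the same value also arises from the derivatives in the
  opposite order: this is what makes mixed derivatives agree.\<close>

lemma mixed_second_difference:
  fixes U Ux Uxy :: "real \<Rightarrow> real \<Rightarrow> real"
  assumes s: "0 < s"
    and Ux: "\<And>x y. 0 \<le> x \<Longrightarrow> x \<le> s \<Longrightarrow> 0 \<le> y \<Longrightarrow> y \<le> s \<Longrightarrow>
               ((\<lambda>t. U t y) has_real_derivative Ux x y) (at x)"
    and Uxy: "\<And>x y. 0 \<le> x \<Longrightarrow> x \<le> s \<Longrightarrow> 0 \<le> y \<Longrightarrow> y \<le> s \<Longrightarrow>
               ((\<lambda>t. Ux x t) has_real_derivative Uxy x y) (at y)"
  shows "\<exists>x y. 0 < x \<and> x < s \<and> 0 < y \<and> y < s \<and>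
           U s s - U s 0 - U 0 s + U 0 0 = s\<^sup>2 * Uxy x y"
proof -
  have "\<exists>x. 0 < x \<and> x < s \<and> (U s s - U s 0) - (U 0 s - U 0 0) = (s - 0) * (Ux x s - Ux x 0)"
    by (rule MVT2[OF s, where f = "\<lambda>x. U x s - U x 0"]) (auto intro!: DERIV_diff Ux simp: s less_imp_le)
  then obtain x where x: "0 < x" "x < s"
    and *: "(U s s - U s 0) - (U 0 s - U 0 0) = s * (Ux x s - Ux x 0)" by auto
  have "\<exists>y. 0 < y \<and> y < s \<and> Ux x s - Ux x 0 = (s - 0) * Uxy x y"
    by (rule MVT2[OF s]) (use x in \<open>auto intro!: Uxy\<close>)
  then obtain y where y: "0 < y" "y < s" and **: "Ux x s - Ux x 0 = s * Uxy x y" by auto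
  have "U s s - U s 0 - U 0 s + U 0 0 = s\<^sup>2 * Uxy x y"
    using * unfolding ** by (simp add: power2_eq_square algebra_simps)
  with x y show ?thesis by blast
qed

lemma dx_has_vector_derivative:
  assumes "f differentiable at (p + Complex x y)"
  shows "((\<lambda>t. f (p + Complex t y)) has_vector_derivative dx f (p + Complex x y)) (at x)"
proof -
  have curve: "((\<lambda>t. p + Complex t y) has_vector_derivative 1) (at x)"
  proof -
    have "((\<lambda>t. (p + \<i> * of_real y) + of_real t) has_vector_derivative 1) (at x)"
      by (auto intro!: derivative_eq_intros)
    then show ?thesis by (simp add: Complex_eq algebra_simps)
  qed
  have f: "(f has_derivative frechet_derivative f (at (p + Complex x y))) (at (p + Complex x y))"
    using assms frechet_derivative_works by blast
  from vector_derivative_diff_chain_within[OF curve has_derivative_at_withinI[OF f]]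
  show ?thesis by (simp add: dx_def o_def)
qed

lemma dy_has_vector_derivative:
  assumes "f differentiable at (p + Complex x y)"
  shows "((\<lambda>t. f (p + Complex x t)) has_vector_derivative dy f (p + Complex x y)) (at y)"
proof -
  have curve: "((\<lambda>t. p + Complex x t) has_vector_derivative \<i>) (at y)"
  proof -
    have "((\<lambda>t. (p + of_real x) + of_real t * \<i>) has_vector_derivative \<i>) (at y)"
      by (auto intro!: derivative_eq_intros)
    then show ?thesis by (simp add: Complex_eq algebra_simps)
  qed
  have f: "(f has_derivative frechet_derivative f (at (p + Complex x y))) (at (p + Complex x y))"
    using assms frechet_derivative_works by blast
  from vector_derivative_diff_chain_within[OF curve has_derivative_at_withinI[OF f]]
  show ?thesis by (simp add: dy_def o_def)
qed

text \<open>If a real linear functional separated the two values, continuity would keep them apart on a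
  small square at \<open>p\<close>; but the second difference over that square is \<open>s\<^sup>2\<close> times either mixed
  derivative at some point of it.\<close>

lemma mixed_partials_commute:
  assumes S: "open S" "p \<in> S"
    and diff: "\<And>z. z \<in> S \<Longrightarrow> f differentiable at z" "\<And>z. z \<in> S \<Longrightarrow> dx f differentiable at z"
       "\<And>z. z \<in> S \<Longrightarrow> dy f differentiable at z"
    and cont: "continuous_on S (dy (dx f))" "continuous_on S (dx (dy f))"
  shows "dy (dx f) p = dx (dy f) p"
proof -
  have real_part: "L (dy (dx f) p) = L (dx (dy f) p)" if L: "bounded_linear L" for L :: "complex \<Rightarrow> real"
  proof (rule ccontr)
    let ?a = "\<lambda>z. L (dy (dx f) z)" and ?b = "\<lambda>z. L (dx (dy f) z)"
    assume ne: "?a p \<noteq> ?b p"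
    define e where "e = dist (?a p) (?b p) / 2"
    have e: "e > 0" using ne by (simp add: e_def)
    have ca: "continuous_on S ?a" and cb: "continuous_on S ?b"
      using cont bounded_linear.continuous_on[OF L] by auto
    then obtain d1 d2 where d: "d1 > 0" "\<And>w. w \<in> S \<Longrightarrow> dist w p < d1 \<Longrightarrow> dist (?a w) (?a p) < e"
      "d2 > 0" "\<And>w. w \<in> S \<Longrightarrow> dist w p < d2 \<Longrightarrow> dist (?b w) (?b p) < e"
      using e S(2) unfolding continuous_on_iff by metis
    obtain d3 where d3: "d3 > 0" "ball p d3 \<subseteq> S" using S open_contains_ball by blast
    \<comment> \<open>points of the square of side \<open>s\<close> at \<open>p\<close> have distance at most \<open>2 s\<close> from \<open>p\<close>\<close>
    define s where "s = Min {d1, d2, d3} / 3"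
    have s: "s > 0" "2 * s < d1" "2 * s < d2" "2 * s < d3"
      using d d3 by (auto simp: s_def min_def)
    have near: "dist (p + Complex x y) p \<le> 2 * s" if "0 \<le> x" "x \<le> s" "0 \<le> y" "y \<le> s" for x y
      using cmod_le[of "Complex x y"] that by (simp add: dist_norm)
    then have inS: "p + Complex x y \<in> S" if "0 \<le> x" "x \<le> s" "0 \<le> y" "y \<le> s" for x y
      using that d3(2) s(4) by (fastforce simp: dist_commute)
    have L': "((\<lambda>t. L (F t)) has_real_derivative L D) (at x)"
      if "(F has_vector_derivative D) (at x)" for F D x
      using bounded_linear.has_vector_derivative[OF L that]
      by (simp add: has_real_derivative_iff_has_vector_derivative)
    have "\<exists>x y. 0 < x \<and> x < s \<and> 0 < y \<and> y < s \<and>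
        L (f (p + Complex s s)) - L (f (p + Complex s 0)) - L (f (p + Complex 0 s))
          + L (f (p + Complex 0 0)) = s\<^sup>2 * ?a (p + Complex x y)"
      by (rule mixed_second_difference[OF s(1), where U = "\<lambda>x y. L (f (p + Complex x y))"
          and Ux = "\<lambda>x y. L (dx f (p + Complex x y))" and Uxy = "\<lambda>x y. ?a (p + Complex x y)"];
        rule L', (rule dx_has_vector_derivative | rule dy_has_vector_derivative), rule diff, rule inS)
    then obtain x y where xy: "0 < x" "x < s" "0 < y" "y < s"
      and 1: "L (f (p + Complex s s)) - L (f (p + Complex s 0)) - L (f (p + Complex 0 s))
        + L (f (p + Complex 0 0)) = s\<^sup>2 * ?a (p + Complex x y)" by blast
    have "\<exists>v u. 0 < v \<and> v < s \<and> 0 < u \<and> u < s \<and>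
        L (f (p + Complex s s)) - L (f (p + Complex 0 s)) - L (f (p + Complex s 0))
          + L (f (p + Complex 0 0)) = s\<^sup>2 * ?b (p + Complex u v)"
      by (rule mixed_second_difference[OF s(1), where U = "\<lambda>y x. L (f (p + Complex x y))"
          and Ux = "\<lambda>y x. L (dy f (p + Complex x y))" and Uxy = "\<lambda>y x. ?b (p + Complex x y)"];
        rule L', (rule dx_has_vector_derivative | rule dy_has_vector_derivative), rule diff, rule inS)
    then obtain v u where uv: "0 < u" "u < s" "0 < v" "v < s"
      and 2: "L (f (p + Complex s s)) - L (f (p + Complex 0 s)) - L (f (p + Complex s 0))
        + L (f (p + Complex 0 0)) = s\<^sup>2 * ?b (p + Complex u v)" by blast
    have "s\<^sup>2 * ?a (p + Complex x y) = s\<^sup>2 * ?b (p + Complex u v)"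
      using 1 2 by linarith
    then have eq: "?a (p + Complex x y) = ?b (p + Complex u v)" using s(1) by simp
    have "dist (p + Complex x y) p < d1"
      using near[of x y] xy s(2) by linarith
    then have da: "dist (?a (p + Complex x y)) (?a p) < e"
      using d(2) inS[of x y] xy by simp
    have "dist (p + Complex u v) p < d2"
      using near[of u v] uv s(3) by linarith
    then have db: "dist (?b (p + Complex u v)) (?b p) < e"
      using d(4) inS[of u v] uv by simp
    have "dist (?a p) (?b p) < 2 * e"
      using da db dist_triangle3[of "?a p" "?b p" "?b (p + Complex u v)"] unfolding eq by linarith
    then show False by (simp add: e_def)
  qed
  show ?thesis
    using real_part[OF bounded_linear_Re] real_part[OF bounded_linear_Im] by (simp add: complex_eq_iff)
qed

text \<open>A real linear map of the plane is determined by its values at \<open>1\<close> and \<open>\<i>\<close>.\<close>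

lemma frechet_derivative_wirtinger:
  assumes "f differentiable at z"
  shows "(f has_derivative (\<lambda>v. dz f z * v + dzbar f z * cnj v)) (at z)"
proof -
  let ?D = "frechet_derivative f (at z)"
  have D: "(f has_derivative ?D) (at z)" using assms frechet_derivative_works by blast
  then interpret bounded_linear ?D by (rule has_derivative_bounded_linear)
  have "?D v = dz f z * v + dzbar f z * cnj v" for v
  proof -
    have "v = Re v *\<^sub>R 1 + Im v *\<^sub>R \<i>" by (simp add: complex_eq_iff)
    then have "?D v = ?D (Re v *\<^sub>R 1 + Im v *\<^sub>R \<i>)" by (rule arg_cong)
    also have "\<dots> = Re v *\<^sub>R dx f z + Im v *\<^sub>R dy f z"
      by (simp add: add scaleR dx_def dy_def)
    also have "\<dots> = dz f z * v + dzbar f z * cnj v"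
      unfolding dz_def dzbar_def by (simp add: complex_eq_iff field_simps)
    finally show ?thesis .
  qed
  then have "?D = (\<lambda>v. dz f z * v + dzbar f z * cnj v)" by (rule ext)
  then show ?thesis using D by simp
qed

lemma holomorphic_on_of_dzbar_zero:
  assumes "open S" "\<And>z. z \<in> S \<Longrightarrow> f differentiable at z" "\<And>z. z \<in> S \<Longrightarrow> dzbar f z = 0"
  shows "f holomorphic_on S"
proof -
  have "(f has_field_derivative dz f z) (at z)" if "z \<in> S" for z
    using frechet_derivative_wirtinger[OF assms(2)[OF that]] assms(3)[OF that]
    by (simp add: has_field_derivative_def)
  then show ?thesis using assms(1) by (auto simp: holomorphic_on_open)
qed

text \<open>The \<open>z\<^sub>b\<^sub>a\<^sub>r\<close>-derivative of \<open>f\<^sub>z\<close> is a quarter of the Laplacian plus a multiple of the difference of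
  the mixed derivatives, and likewise for the conjugate of \<open>f\<^sub>z\<^sub>b\<^sub>a\<^sub>r\<close>.\<close>

lemma harmonic_on_imp_holomorphic_dz:
  assumes f: "harmonic_on f S" and S: "open S"
  shows "dz f holomorphic_on S" and "(\<lambda>z. cnj (dzbar f z)) holomorphic_on S"
proof -
  have diff: "\<And>z. z \<in> S \<Longrightarrow> f differentiable at z" "\<And>z. z \<in> S \<Longrightarrow> dx f differentiable at z"
     "\<And>z. z \<in> S \<Longrightarrow> dy f differentiable at z"
    and lap: "\<And>z. z \<in> S \<Longrightarrow> dx (dx f) z + dy (dy f) z = 0"
    and cont: "continuous_on S (dy (dx f))" "continuous_on S (dx (dy f))"
    using f by (auto simp: harmonic_on_def)
  have mixed: "dy (dx f) z = dx (dy f) z" if "z \<in> S" for z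
    by (rule mixed_partials_commute[OF S that diff cont])
  have deriv_combination:
    "((\<lambda>w. (dx f w + c * dy f w) / 2) has_derivative
      (\<lambda>v. (frechet_derivative (dx f) (at z) v + c * frechet_derivative (dy f) (at z) v) / 2)) (at z)"
    if "z \<in> S" for z c
    using diff(2,3)[OF that] unfolding frechet_derivative_works
    by (auto intro!: derivative_eq_intros)
  show "dz f holomorphic_on S"
  proof (rule holomorphic_on_of_dzbar_zero[OF S])
    fix z assume z: "z \<in> S"
    have eq: "dz f = (\<lambda>w. (dx f w + (- \<i>) * dy f w) / 2)" by (simp add: fun_eq_iff dz_def)
    note D = deriv_combination[OF z, of "- \<i>"]
    show "dz f differentiable at z" using D unfolding eq differentiable_def by blast
    have partials: "dx (dz f) z = (dx (dx f) z - \<i> * dx (dy f) z) / 2"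
      "dy (dz f) z = (dy (dx f) z - \<i> * dy (dy f) z) / 2"
      unfolding eq using frechet_derivative_at[OF D, symmetric] by (simp_all add: dx_def dy_def)
    have "dzbar (dz f) z = ((dx (dx f) z + dy (dy f) z) + \<i> * (dy (dx f) z - dx (dy f) z)) / 4"
      unfolding dzbar_def[of "dz f"] partials by (simp add: field_simps)
    then show "dzbar (dz f) z = 0"
      using lap[OF z] mixed[OF z] by simp
  qed
  show "(\<lambda>z. cnj (dzbar f z)) holomorphic_on S"
  proof (rule holomorphic_on_of_dzbar_zero[OF S])
    fix z assume z: "z \<in> S"
    have D: "((\<lambda>w. cnj (dzbar f w)) has_derivative
      (\<lambda>v. cnj ((frechet_derivative (dx f) (at z) v + \<i> * frechet_derivative (dy f) (at z) v) / 2))) (at z)"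
      using deriv_combination[OF z, of "\<i>"] unfolding dzbar_def by (rule has_derivative_cnj)
    show "(\<lambda>w. cnj (dzbar f w)) differentiable at z" using D unfolding differentiable_def by blast
    have partials: "dx (\<lambda>w. cnj (dzbar f w)) z = cnj ((dx (dx f) z + \<i> * dx (dy f) z) / 2)"
      "dy (\<lambda>w. cnj (dzbar f w)) z = cnj ((dy (dx f) z + \<i> * dy (dy f) z) / 2)"
      using frechet_derivative_at[OF D, symmetric] by (simp_all add: dx_def dy_def)
    have "dzbar (\<lambda>w. cnj (dzbar f w)) z = cnj ((dx (dx f) z + dy (dy f) z) + \<i> * (dx (dy f) z - dy (dx f) z)) / 4"
      unfolding dzbar_def[of "\<lambda>w. cnj (dzbar f w)"] partials by (simp add: field_simps)
    then show "dzbar (\<lambda>w. cnj (dzbar f w)) z = 0"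
      using lap[OF z] mixed[OF z] by simp
  qed
qed

text \<open>\<open>h\<close> and \<open>g\<close> are primitives of \<open>f\<^sub>z\<close> and of the conjugate of \<open>f\<^sub>z\<^sub>b\<^sub>a\<^sub>r\<close>, shifted to the right values at
  0; then \<open>f - (h + cnj g)\<close> has derivative zero in the convex disc and vanishes at 0.\<close>

lemma harmonic_on_disc_decomposition:
  assumes f: "harmonic_on f unit_disc"
  obtains h g where "h holomorphic_on unit_disc" "g holomorphic_on unit_disc"
    "h 0 = f 0" "g 0 = 0" "\<And>z. z \<in> unit_disc \<Longrightarrow> f z = h z + cnj (g z)"
    "\<And>z. z \<in> unit_disc \<Longrightarrow> (h has_field_derivative dz f z) (at z)"
    "\<And>z. z \<in> unit_disc \<Longrightarrow> (g has_field_derivative cnj (dzbar f z)) (at z)"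
proof -
  have o: "open unit_disc" and cv: "convex unit_disc" and z0: "0 \<in> unit_disc" by auto
  note hol = harmonic_on_imp_holomorphic_dz[OF f o]
  obtain h0 where h0: "\<And>z. z \<in> unit_disc \<Longrightarrow> (h0 has_field_derivative dz f z) (at z)"
    using holomorphic_convex_primitive'[OF cv o hol(1)] at_within_open[OF _ o] by metis
  obtain g0 where g0: "\<And>z. z \<in> unit_disc \<Longrightarrow> (g0 has_field_derivative cnj (dzbar f z)) (at z)"
    using holomorphic_convex_primitive'[OF cv o hol(2)] at_within_open[OF _ o] by metis
  define h where "h z = h0 z - h0 0 + f 0" for z
  define g where "g z = g0 z - g0 0" for z
  have h: "(h has_field_derivative dz f z) (at z)" if "z \<in> unit_disc" for z
    unfolding h_def using h0[OF that] by (auto intro!: derivative_eq_intros)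
  have g: "(g has_field_derivative cnj (dzbar f z)) (at z)" if "z \<in> unit_disc" for z
    unfolding g_def using g0[OF that] by (auto intro!: derivative_eq_intros)
  have "((\<lambda>w. f w - (h w + cnj (g w))) has_derivative (\<lambda>v. 0)) (at z within unit_disc)"
    if z: "z \<in> unit_disc" for z
  proof -
    have "(f has_derivative (\<lambda>v. dz f z * v + dzbar f z * cnj v)) (at z)"
      using f z by (intro frechet_derivative_wirtinger) (auto simp: harmonic_on_def)
    moreover have "((\<lambda>w. h w + cnj (g w)) has_derivative (\<lambda>v. dz f z * v + cnj (cnj (dzbar f z) * v))) (at z)"
      by (rule holomorphic_plus_conj_derivative(1)[OF o z _ h[OF z] g[OF z]]) simp
    ultimately have "((\<lambda>w. f w - (h w + cnj (g w))) has_derivative (\<lambda>v. 0)) (at z)"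
      by (rule has_derivative_eq_rhs[OF has_derivative_diff]) simp
    then show ?thesis by (rule has_derivative_at_withinI)
  qed
  then have "\<exists>c. \<forall>z\<in>unit_disc. f z - (h z + cnj (g z)) = c"
    by (rule has_derivative_zero_constant[OF cv])
  then obtain c where c: "\<And>z. z \<in> unit_disc \<Longrightarrow> f z - (h z + cnj (g z)) = c" by blast
  have hg0: "h 0 = f 0" "g 0 = 0" by (simp_all add: h_def g_def)
  then have "c = 0" using c[OF z0] by simp
  then have "f z = h z + cnj (g z)" if "z \<in> unit_disc" for z using c[OF that] by simp
  moreover have "h holomorphic_on unit_disc" "g holomorphic_on unit_disc"
    unfolding holomorphic_on_open[OF o] using h g by blast+
  ultimately show ?thesis using that hg0 h g by blast
qed

section \<open>Power series in the disc and harmonic expansions\<close>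

definition disc_summable :: "(nat \<Rightarrow> complex) \<Rightarrow> bool" where
  "disc_summable a \<longleftrightarrow> (\<forall>z\<in>unit_disc. summable (\<lambda>n. a n * z ^ n))"

definition power_sum :: "(nat \<Rightarrow> complex) \<Rightarrow> complex \<Rightarrow> complex" where
  "power_sum a z = (\<Sum>n. a n * z ^ n)"

lemma harmonic_series_eq: "harmonic_series a b z = power_sum a z + cnj (power_sum b z)"
  by (simp add: harmonic_series_def power_sum_def)

lemma disc_summableD: "disc_summable a \<Longrightarrow> z \<in> unit_disc \<Longrightarrow> (\<lambda>n. a n * z ^ n) sums power_sum a z"
  by (auto simp: disc_summable_def power_sum_def summable_sums)

lemma disc_summable_diffs: "disc_summable a \<Longrightarrow> disc_summable (diffs a)"
  unfolding disc_summable_def by (auto intro: termdiff_converges[where K = 1])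

lemma power_sum_has_field_derivative:
  assumes "disc_summable a" "z \<in> unit_disc"
  shows "(power_sum a has_field_derivative power_sum (diffs a) z) (at z)"
  using termdiffs_strong'[where K = 1 and c = a and z = z] assms
  by (auto simp: power_sum_def[abs_def] disc_summable_def)

lemma power_sum_holomorphic: "disc_summable a \<Longrightarrow> power_sum a holomorphic_on unit_disc"
  by (auto simp: holomorphic_on_open intro: power_sum_has_field_derivative)

lemma index_mult_series:
  assumes "disc_summable a"
  shows "disc_summable (\<lambda>n. of_nat n * a n)"
    and "z \<in> unit_disc \<Longrightarrow> z * power_sum (diffs a) z = power_sum (\<lambda>n. of_nat n * a n) z"
proof -
  have *: "(\<lambda>n. of_nat n * a n * z ^ n) sums (z * power_sum (diffs a) z)" if "z \<in> unit_disc" for z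
  proof -
    have "(\<lambda>n. of_nat n * a n * z ^ (n - Suc 0)) sums power_sum (diffs a) z"
      unfolding power_sum_def using disc_summable_diffs[OF assms] that
      by (intro diffs_equiv) (auto simp: disc_summable_def)
    then have "(\<lambda>n. z * (of_nat n * a n * z ^ (n - Suc 0))) sums (z * power_sum (diffs a) z)"
      by (rule sums_mult)
    moreover have "z * (of_nat n * a n * z ^ (n - Suc 0)) = of_nat n * a n * z ^ n" for n
      by (cases n) auto
    ultimately show ?thesis by simp
  qed
  show "disc_summable (\<lambda>n. of_nat n * a n)"
    unfolding disc_summable_def using * sums_summable by blast
  show "z * power_sum (diffs a) z = power_sum (\<lambda>n. of_nat n * a n) z" if "z \<in> unit_disc"
    unfolding power_sum_def[of "\<lambda>n. of_nat n * a n"] using *[OF that] sums_unique by blast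
qed

lemma power_sum_zero: "power_sum a 0 = a 0"
  unfolding power_sum_def by (simp add: powser_zero)

text \<open>The coefficient of index 0 is the value at 0; the others follow by induction on the index, as
  differentiation shifts the coefficients.\<close>

lemma power_sum_eq_imp_coeff_eq:
  assumes a: "disc_summable a" and b: "disc_summable b"
    and eq: "\<And>z. z \<in> unit_disc \<Longrightarrow> power_sum a z = power_sum b z"
  shows "a = b"
proof -
  have *: "\<forall>a b. disc_summable a \<longrightarrow> disc_summable b \<longrightarrow>
      (\<forall>z\<in>unit_disc. power_sum a z = power_sum b z) \<longrightarrow> a n = b n" for n
  proof (induction n)
    case 0
    then show ?case using power_sum_zero by (metis centre_in_ball zero_less_one)
  next
    case (Suc n)
    show ?case
    proof (intro allI impI)
      fix a b assume a: "disc_summable a" and b: "disc_summable b"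
        and eq: "\<forall>z\<in>unit_disc. power_sum a z = power_sum b z"
      have "power_sum (diffs a) z = power_sum (diffs b) z" if z: "z \<in> unit_disc" for z
      proof -
        have "(power_sum b has_field_derivative power_sum (diffs a) z) (at z)"
          by (rule has_field_derivative_transform_within_open
              [OF power_sum_has_field_derivative[OF a z] open_ball z]) (use eq in auto)
        then show ?thesis using power_sum_has_field_derivative[OF b z] DERIV_unique by blast
      qed
      then have "diffs a n = diffs b n" using Suc disc_summable_diffs a b by blast
      then show "a (Suc n) = b (Suc n)" by (simp add: diffs_def del: of_nat_Suc)
    qed
  qed
  then show ?thesis using a b eq by blast
qed

lemma harmonic_series_wirtinger:
  assumes "disc_summable a" "disc_summable b" "z \<in> unit_disc"
  shows "dz (harmonic_series a b) z = power_sum (diffs a) z"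
    and "dzbar (harmonic_series a b) z = cnj (power_sum (diffs b) z)"
    and "(harmonic_series a b has_derivative
           (\<lambda>v. power_sum (diffs a) z * v + cnj (power_sum (diffs b) z * v))) (at z)"
  using holomorphic_plus_conj_derivative[OF open_ball assms(3) harmonic_series_eq
      power_sum_has_field_derivative[OF assms(1,3)] power_sum_has_field_derivative[OF assms(2,3)]]
  by blast+

lemma harmonic_series_harmonic:
  "disc_summable a \<Longrightarrow> disc_summable b \<Longrightarrow> harmonic_on (harmonic_series a b) unit_disc"
  by (rule harmonic_on_holomorphic_plus_conj[OF open_ball harmonic_series_eq])
    (auto intro: power_sum_holomorphic)

lemma harmonic_expansion_alt:
  "harmonic_expansion f a b \<longleftrightarrow> a 0 = 0 \<and> a 1 = 1 \<and> b 0 = 0 \<and> b 1 = 0 \<and>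
     disc_summable a \<and> disc_summable b \<and> (\<forall>z\<in>unit_disc. f z = harmonic_series a b z)"
  unfolding harmonic_expansion_def disc_summable_def by blast

lemma wirtinger_cong:
  assumes "open S" "z \<in> S" "\<And>w. w \<in> S \<Longrightarrow> f w = g w"
  shows "dz f z = dz g z" "dzbar f z = dzbar g z"
proof -
  have "(f has_derivative D) (at z) \<longleftrightarrow> (g has_derivative D) (at z)" for D
    using assms has_derivative_transform_within_open by metis
  then have "frechet_derivative f (at z) = frechet_derivative g (at z)"
    by (simp add: frechet_derivative_def)
  then show "dz f z = dz g z" "dzbar f z = dzbar g z" by (simp_all add: dz_def dzbar_def dx_def dy_def)
qed

lemma harmonic_expansion_wirtinger:
  assumes "harmonic_expansion f a b" "z \<in> unit_disc"
  shows "dz f z = power_sum (diffs a) z" "dzbar f z = cnj (power_sum (diffs b) z)"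
  using assms wirtinger_cong[OF open_ball assms(2), of f "harmonic_series a b"]
    harmonic_series_wirtinger(1,2)[of a b z]
  by (auto simp: harmonic_expansion_alt)

lemma diffs_inject:
  fixes a b :: "nat \<Rightarrow> complex"
  assumes "diffs a = diffs b" "a 0 = b 0"
  shows "a = b"
proof
  fix n show "a n = b n"
  proof (cases n)
    case (Suc m)
    have "diffs a m = diffs b m" using assms(1) by simp
    then show ?thesis unfolding Suc by (simp add: diffs_def del: of_nat_Suc)
  qed (use assms(2) in simp)
qed

text \<open>The Wirtinger derivatives separate the two power series, since they are \<open>h'\<close> and the
  conjugate of \<open>g'\<close>.\<close>

lemma harmonic_coeffs_eqI:
  assumes f: "harmonic_expansion f a b"
  shows "harmonic_coeffs f = (a, b)"
  unfolding harmonic_coeffs_def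
proof (rule the_equality)
  show "case (a, b) of (a, b) \<Rightarrow> harmonic_expansion f a b" using f by simp
next
  fix p assume "case p of (a, b) \<Rightarrow> harmonic_expansion f a b"
  then obtain a' b' where p: "p = (a', b')" and f': "harmonic_expansion f a' b'" by (cases p) auto
  have s: "disc_summable (diffs a)" "disc_summable (diffs a')"
      "disc_summable (diffs b)" "disc_summable (diffs b')"
    using f f' by (auto simp: harmonic_expansion_alt disc_summable_diffs)
  have "diffs a = diffs a'" "diffs b = diffs b'"
    using harmonic_expansion_wirtinger[OF f] harmonic_expansion_wirtinger[OF f']
    by (auto intro!: power_sum_eq_imp_coeff_eq s)
  then show "p = (a, b)"
    using f f' diffs_inject unfolding p harmonic_expansion_alt by (metis prod.inject)
qed

lemma hconv_eq_harmonic_series: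
  assumes "harmonic_expansion f a b" "harmonic_expansion F A B"
  shows "f \<star> F = harmonic_series (\<lambda>n. a n * A n) (\<lambda>n. b n * B n)"
  unfolding hconv_def harmonic_coeffs_eqI[OF assms(1)] harmonic_coeffs_eqI[OF assms(2)] by simp

section \<open>The Bessel inequality for power series\<close>

lemma integral_cis_int:
  fixes k :: int
  shows "((\<lambda>t. cis (of_int k * t)) has_integral (if k = 0 then of_real (2 * pi) else 0)) {0..2 * pi}"
proof (cases "k = 0")
  case True
  then show ?thesis using has_integral_const_real[of "1 :: complex" 0 "2 * pi"]
    by (simp add: scaleR_conv_of_real)
next
  case False
  have "((\<lambda>t. cis (of_int k * t) / (\<i> * of_int k)) has_vector_derivative cis (of_int k * t))
      (at t within {0..2 * pi})" for t
  proof -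
    have "((\<lambda>t. cis (of_int k * t)) has_derivative (\<lambda>h. (of_int k * h) *\<^sub>R (\<i> * cis (of_int k * t))))
        (at t within {0..2 * pi})"
      by (rule has_derivative_cis) (auto intro!: derivative_eq_intros)
    then have "((\<lambda>t. cis (of_int k * t)) has_vector_derivative \<i> * of_int k * cis (of_int k * t))
        (at t within {0..2 * pi})"
      by (simp add: has_vector_derivative_def scaleR_conv_of_real mult_ac)
    then have "((\<lambda>t. cis (of_int k * t) / (\<i> * of_int k)) has_vector_derivative
        \<i> * of_int k * cis (of_int k * t) / (\<i> * of_int k)) (at t within {0..2 * pi})"
      by (rule has_vector_derivative_divide)
    then show ?thesis using False by simp
  qed
  then have "((\<lambda>t. cis (of_int k * t)) has_integral
      (cis (of_int k * (2 * pi)) / (\<i> * of_int k) - cis (of_int k * 0) / (\<i> * of_int k))) {0..2 * pi}"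
    by (intro fundamental_theorem_of_calculus) auto
  moreover have "cis (of_int k * (2 * pi)) = 1"
    using cis_multiple_2pi[of "of_int k"] by (simp add: mult_ac)
  ultimately show ?thesis using False by simp
qed

text \<open>On a circle of radius \<open>r < 1\<close> the series converges uniformly, so it may be integrated term by
  term, and only the term of index \<open>m\<close> survives.\<close>

lemma fourier_coefficient_power_sum:
  assumes a: "disc_summable a" and r: "0 \<le> r" "r < 1"
  shows "((\<lambda>t. power_sum a (of_real r * cis t) * cnj ((of_real r * cis t) ^ m)) has_integral
           of_real (2 * pi * r ^ (2 * m)) * a m) {0..2 * pi}"
proof -
  let ?z = "\<lambda>t. of_real r * cis t"
  let ?S = "\<lambda>N t. (\<Sum>n<N. a n * ?z t ^ n) * cnj (?z t ^ m)"
  \<comment> \<open>a radius between \<open>r\<close> and 1, at which convergence gives absolute convergence at \<open>r\<close>\<close>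
  define R where "R = (r + 1) / 2"
  have R: "r < R" "R < 1" "0 \<le> R" using r by (auto simp: R_def)
  have sR: "summable (\<lambda>n. norm (a n * of_real r ^ n))"
    by (rule powser_insidea[where x = "of_real R"]) (use a R r in \<open>auto simp: disc_summable_def\<close>)
  have "uniform_limit {0..2 * pi} (\<lambda>N t. \<Sum>n<N. a n * ?z t ^ n) (\<lambda>t. \<Sum>n. a n * ?z t ^ n) sequentially"
    by (rule Weierstrass_m_test[OF _ sR]) (use r in \<open>auto simp: norm_mult norm_power\<close>)
  moreover have "bounded ((\<lambda>t. cnj (?z t ^ m)) ` {0..2 * pi})"
    by (intro compact_imp_bounded compact_continuous_image continuous_intros) auto
  moreover have "bounded ((\<lambda>t. \<Sum>n. a n * ?z t ^ n) ` {0..2 * pi})"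
    by (rule boundedI[where B = "\<Sum>n. norm (a n * of_real r ^ n)"])
      (use sR r in \<open>auto intro!: norm_suminf_le simp: norm_mult norm_power\<close>)
  ultimately have "uniform_limit {0..2 * pi} ?S (\<lambda>t. power_sum a (?z t) * cnj (?z t ^ m)) sequentially"
    unfolding power_sum_def by (intro uniform_lim_mult uniform_limit_const) auto
  then obtain I J where I: "\<And>N. (?S N has_integral I N) {0..2 * pi}"
    and J: "((\<lambda>t. power_sum a (?z t) * cnj (?z t ^ m)) has_integral J) {0..2 * pi}" "I \<longlonglongrightarrow> J"
    by (rule uniform_limit_integral) (auto intro!: continuous_intros)
  have "(?S N has_integral (\<Sum>n<N. if n = m then of_real (2 * pi * r ^ (2 * m)) * a m else 0)) {0..2 * pi}" for N
  proof -
    have "((\<lambda>t. a n * ?z t ^ n * cnj (?z t ^ m)) has_integral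
        (if n = m then of_real (2 * pi * r ^ (2 * m)) * a m else 0)) {0..2 * pi}" for n
    proof -
      have "((\<lambda>t. a n * of_real r ^ (n + m) * cis (of_int (int n - int m) * t)) has_integral
          a n * of_real r ^ (n + m) * (if int n - int m = 0 then of_real (2 * pi) else 0)) {0..2 * pi}"
        by (intro has_integral_mult_right integral_cis_int)
      moreover have "a n * of_real r ^ (n + m) * cis (of_int (int n - int m) * t)
          = a n * ?z t ^ n * cnj (?z t ^ m)" for t
        by (simp add: power_add power_mult_distrib Complex.DeMoivre cis_cnj cis_mult algebra_simps)
      moreover have "a n * of_real r ^ (n + m) * (if int n - int m = 0 then of_real (2 * pi) else 0)
          = (if n = m then of_real (2 * pi * r ^ (2 * m)) * a m else 0)"
      proof (cases "n = m")
        case True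
        then have "n + m = 2 * m" by simp
        then show ?thesis unfolding \<open>n + m = 2 * m\<close> using True by (simp only: simp_thms if_True diff_self of_real_mult of_real_power mult_ac)
      qed simp
      ultimately show ?thesis by (simp only:)
    qed
    then show ?thesis unfolding sum_distrib_right by (intro has_integral_sum) auto
  qed
  then have I_eq: "I = (\<lambda>N. \<Sum>n<N. if n = m then of_real (2 * pi * r ^ (2 * m)) * a m else 0)"
    using I has_integral_unique by blast
  have "\<forall>\<^sub>F N in sequentially. I N = of_real (2 * pi * r ^ (2 * m)) * a m"
    using eventually_gt_at_top[of m] by eventually_elim (simp add: I_eq)
  then have "I \<longlonglongrightarrow> of_real (2 * pi * r ^ (2 * m)) * a m" by (rule tendsto_eventually)
  then show ?thesis using J LIMSEQ_unique by blast
qed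

text \<open>For a Taylor polynomial \<open>s\<close> of \<open>u\<close> one has \<open>2 Re (u * cnj s) - |s|\<^sup>2 \<le> |u|\<^sup>2\<close> pointwise, and the mean of the
  left-hand side over the circle of radius \<open>r\<close> is \<open>\<Sum> |a\<^sub>n|\<^sup>2 r\<^sup>2\<^sup>n\<close>. Adding the two series before
  integrating is essential, as only the sum of squares is bounded. Finally \<open>r \<rightarrow> 1\<close>.\<close>

lemma bessel_power_sum_pair:
  assumes a: "disc_summable a" and b: "disc_summable b"
    and bound: "\<And>z. z \<in> unit_disc \<Longrightarrow> (cmod (power_sum a z))\<^sup>2 + (cmod (power_sum b z))\<^sup>2 \<le> C"
  shows "(\<Sum>n<N. (cmod (a n))\<^sup>2 + (cmod (b n))\<^sup>2) \<le> C"
proof -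
  have on_circle: "(\<Sum>n<N. ((cmod (a n))\<^sup>2 + (cmod (b n))\<^sup>2) * r ^ (2 * n)) \<le> C"
    if r: "0 \<le> r" "r < 1" for r
  proof -
    let ?z = "\<lambda>t. of_real r * cis t"
    have z: "?z t \<in> unit_disc" for t using r by (simp add: norm_mult)
    have pairing: "((\<lambda>t. Re (power_sum c (?z t) * cnj (\<Sum>n<N. d n * ?z t ^ n))) has_integral
        (\<Sum>n<N. 2 * pi * r ^ (2 * n) * Re (c n * cnj (d n)))) {0..2 * pi}"
      if c: "disc_summable c" for c d
    proof -
      have "((\<lambda>t. \<Sum>n<N. cnj (d n) * (power_sum c (?z t) * cnj (?z t ^ n))) has_integral
          (\<Sum>n<N. cnj (d n) * (of_real (2 * pi * r ^ (2 * n)) * c n))) {0..2 * pi}"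
        by (intro has_integral_sum has_integral_mult_right fourier_coefficient_power_sum c r) auto
      from has_integral_linear[OF this bounded_linear_Re] show ?thesis
        by (simp add: o_def sum_distrib_left mult_ac Re_sum[symmetric] del: Re_sum)
          (simp add: algebra_simps)
    qed
    have norm_sq: "Re (w * cnj w) = (cmod w)\<^sup>2" for w
      unfolding cmod_power2 by (simp add: power2_eq_square)
    \<comment> \<open>A Taylor polynomial is itself a power series, so \<open>|s|\<^sup>2\<close> is integrated by the same pairing.\<close>
    have trunc: "(\<lambda>n. (if n < N then c n else 0) * z ^ n) sums (\<Sum>n<N. c n * z ^ n)" for c :: "nat \<Rightarrow> complex" and z
      using sums_If_finite_set[of "{..<N}" "\<lambda>n. c n * z ^ n"] by (simp add: if_distrib[of "\<lambda>x. x * _"] cong: if_cong)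
    have lower: "((\<lambda>t. 2 * Re (power_sum c (?z t) * cnj (\<Sum>n<N. c n * ?z t ^ n)) - (cmod (\<Sum>n<N. c n * ?z t ^ n))\<^sup>2)
        has_integral 2 * pi * (\<Sum>n<N. (cmod (c n))\<^sup>2 * r ^ (2 * n))) {0..2 * pi}"
      if c: "disc_summable c" for c
    proof -
      let ?c = "\<lambda>n. if n < N then c n else 0"
      have p: "power_sum ?c z = (\<Sum>n<N. c n * z ^ n)" for z
        unfolding power_sum_def using trunc sums_unique by metis
      have "disc_summable ?c" unfolding disc_summable_def using trunc sums_summable by blast
      from has_integral_diff[OF has_integral_mult_right[OF pairing[OF c, of c], of 2] pairing[OF this, of c]]
      have "((\<lambda>t. 2 * Re (power_sum c (?z t) * cnj (\<Sum>n<N. c n * ?z t ^ n)) - (cmod (\<Sum>n<N. c n * ?z t ^ n))\<^sup>2)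
        has_integral 2 * (\<Sum>n<N. 2 * pi * r ^ (2 * n) * Re (c n * cnj (c n)))
          - (\<Sum>n<N. 2 * pi * r ^ (2 * n) * Re (?c n * cnj (c n)))) {0..2 * pi}"
        unfolding p norm_sq by simp
      also have "(\<Sum>n<N. 2 * pi * r ^ (2 * n) * Re (?c n * cnj (c n)))
          = (\<Sum>n<N. 2 * pi * r ^ (2 * n) * Re (c n * cnj (c n)))"
        by (rule sum.cong) auto
      also have "2 * (\<Sum>n<N. 2 * pi * r ^ (2 * n) * Re (c n * cnj (c n)))
          - (\<Sum>n<N. 2 * pi * r ^ (2 * n) * Re (c n * cnj (c n)))
          = 2 * pi * (\<Sum>n<N. (cmod (c n))\<^sup>2 * r ^ (2 * n))"
        unfolding norm_sq by (simp add: sum_distrib_left mult_ac)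
      finally show ?thesis .
    qed
    have square: "2 * Re (u * cnj s) - (cmod s)\<^sup>2 \<le> (cmod u)\<^sup>2" for u s
    proof -
      have "0 \<le> (cmod (u - s))\<^sup>2" by simp
      then show ?thesis unfolding cmod_power2 by (simp add: power2_eq_square algebra_simps)
    qed
    have "2 * pi * (\<Sum>n<N. (cmod (a n))\<^sup>2 * r ^ (2 * n)) + 2 * pi * (\<Sum>n<N. (cmod (b n))\<^sup>2 * r ^ (2 * n)) \<le> 2 * pi * C"
    proof (rule has_integral_le[OF has_integral_add[OF lower[OF a] lower[OF b]]])
      show "((\<lambda>t. C) has_integral 2 * pi * C) {0..2 * pi}"
        using has_integral_const_real[of C 0 "2 * pi"] by simp
    qed (rule order_trans[OF add_mono[OF square square] bound[OF z]])
    then have "2 * pi * ((\<Sum>n<N. (cmod (a n))\<^sup>2 * r ^ (2 * n)) + (\<Sum>n<N. (cmod (b n))\<^sup>2 * r ^ (2 * n))) \<le> 2 * pi * C"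
      by (simp add: distrib_left)
    then show ?thesis
      by (simp add: distrib_right sum.distrib)
  qed
  have "((\<lambda>r. \<Sum>n<N. ((cmod (a n))\<^sup>2 + (cmod (b n))\<^sup>2) * r ^ (2 * n)) \<longlongrightarrow>
      (\<Sum>n<N. ((cmod (a n))\<^sup>2 + (cmod (b n))\<^sup>2) * 1 ^ (2 * n))) (at_left 1)"
    by (intro tendsto_intros)
  moreover have "\<forall>\<^sub>F r in at_left (1 :: real). (\<Sum>n<N. ((cmod (a n))\<^sup>2 + (cmod (b n))\<^sup>2) * r ^ (2 * n)) \<le> C"
    using eventually_at_left_real[of 0 1] by (auto elim!: eventually_mono intro!: on_circle)
  ultimately show ?thesis by (auto intro: tendsto_upperbound)
qed

section \<open>Coefficient bounds for the class and for convolutions\<close>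

text \<open>The Bessel inequality for \<open>h' - 1\<close> and \<open>g'\<close>, whose coefficients of index \<open>n - 1\<close> are
  \<open>n a\<^sub>n\<close> and \<open>n b\<^sub>n\<close>.\<close>

lemma FH0_expansion:
  assumes f: "f \<in> FH0 lam"
  obtains a b where "harmonic_expansion f a b"
    "\<And>N. (\<Sum>n=2..N. (real n)\<^sup>2 * ((cmod (a n))\<^sup>2 + (cmod (b n))\<^sup>2)) \<le> lam\<^sup>2"
proof -
  have f_props: "harmonic_on f unit_disc" "f 0 = 0" "dz f 0 = 1" "dzbar f 0 = 0"
    "\<And>z. z \<in> unit_disc \<Longrightarrow> cmod (dz f z - 1) < lam - cmod (dzbar f z)"
    using f by (auto simp: FH0_def)
  obtain h g where hg: "h holomorphic_on unit_disc" "g holomorphic_on unit_disc"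
    "h 0 = f 0" "g 0 = 0" "\<And>z. z \<in> unit_disc \<Longrightarrow> f z = h z + cnj (g z)"
    "\<And>z. z \<in> unit_disc \<Longrightarrow> (h has_field_derivative dz f z) (at z)"
    "\<And>z. z \<in> unit_disc \<Longrightarrow> (g has_field_derivative cnj (dzbar f z)) (at z)"
    using harmonic_on_disc_decomposition[OF f_props(1)] by metis
  define a where "a n = (deriv ^^ n) h 0 / fact n" for n
  define b where "b n = (deriv ^^ n) g 0 / fact n" for n
  have "(\<lambda>n. a n * z ^ n) sums h z" "(\<lambda>n. b n * z ^ n) sums g z" if "z \<in> unit_disc" for z
    using holomorphic_power_series[OF hg(1) that] holomorphic_power_series[OF hg(2) that]
    by (simp_all add: a_def b_def)
  then have sum: "disc_summable a" "disc_summable b"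
    "\<And>z. z \<in> unit_disc \<Longrightarrow> h z = power_sum a z" "\<And>z. z \<in> unit_disc \<Longrightarrow> g z = power_sum b z"
    unfolding disc_summable_def power_sum_def by (auto simp: sums_iff)
  have "deriv h 0 = 1" "deriv g 0 = 0"
    using hg(6,7)[of 0] f_props(3,4) by (auto intro: DERIV_imp_deriv)
  then have init: "a 0 = 0" "a 1 = 1" "b 0 = 0" "b 1 = 0"
    using hg(3,4) f_props(2) by (simp_all add: a_def b_def)
  have ex: "harmonic_expansion f a b"
    using init sum hg(5) by (auto simp: harmonic_expansion_alt harmonic_series_eq)
  \<comment> \<open>the Taylor coefficients of \<open>f\<^sub>z - 1\<close>\<close>
  define p where "p n = (if n = 0 then 0 else diffs a n)" for n
  have p: "disc_summable p" "power_sum p z = power_sum (diffs a) z - 1" if "z \<in> unit_disc" for z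
  proof -
    have *: "(\<lambda>n. p n * w ^ n) sums (power_sum (diffs a) w - 1)" if "w \<in> unit_disc" for w
    proof -
      have "(\<lambda>n. diffs a n * w ^ n - (if n = 0 then 1 else 0)) sums (power_sum (diffs a) w - 1)"
        by (intro sums_diff disc_summableD disc_summable_diffs sum that) (rule sums_single)
      moreover have "diffs a n * w ^ n - (if n = 0 then 1 else 0) = p n * w ^ n" for n
        using init by (simp add: p_def diffs_def)
      ultimately show ?thesis by simp
    qed
    show "disc_summable p" unfolding disc_summable_def using * sums_summable by blast
    show "power_sum p z = power_sum (diffs a) z - 1"
      unfolding power_sum_def[of p] using *[OF that] sums_unique by metis
  qed
  have "(\<Sum>n<N. (cmod (p n))\<^sup>2 + (cmod (diffs b n))\<^sup>2) \<le> lam\<^sup>2" for N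
  proof (rule bessel_power_sum_pair)
    show "disc_summable p" using p[of 0] by simp
    show "disc_summable (diffs b)" using sum disc_summable_diffs by blast
    fix z :: complex assume z: "z \<in> unit_disc"
    let ?u = "cmod (power_sum p z)" and ?v = "cmod (power_sum (diffs b) z)"
    have "?u + ?v \<le> lam"
      using f_props(5)[OF z] p(2)[OF z] harmonic_expansion_wirtinger[OF ex z] by simp
    then have "(?u + ?v)\<^sup>2 \<le> lam\<^sup>2" by (intro power_mono) auto
    moreover have "?u\<^sup>2 + ?v\<^sup>2 \<le> (?u + ?v)\<^sup>2" by (simp add: power2_sum)
    ultimately show "?u\<^sup>2 + ?v\<^sup>2 \<le> lam\<^sup>2" by linarith
  qed
  note bessel = this
  have "(\<Sum>n=2..N. (real n)\<^sup>2 * ((cmod (a n))\<^sup>2 + (cmod (b n))\<^sup>2)) \<le> lam\<^sup>2" for N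
  proof -
    have "(\<Sum>n=2..N. (real n)\<^sup>2 * ((cmod (a n))\<^sup>2 + (cmod (b n))\<^sup>2))
        = (\<Sum>n=1..<N. (real (Suc n))\<^sup>2 * ((cmod (a (Suc n)))\<^sup>2 + (cmod (b (Suc n)))\<^sup>2))"
      using sum.shift_bounds_Suc_ivl[of "\<lambda>n. (real n)\<^sup>2 * ((cmod (a n))\<^sup>2 + (cmod (b n))\<^sup>2)" 1 N]
      by (simp add: atLeastLessThanSuc_atLeastAtMost numeral_2_eq_2)
    also have "\<dots> = (\<Sum>n=1..<N. (cmod (p n))\<^sup>2 + (cmod (diffs b n))\<^sup>2)"
      by (intro sum.cong)
        (auto simp: p_def diffs_def norm_mult power_mult_distrib distrib_left simp del: of_nat_Suc)
    also have "\<dots> \<le> (\<Sum>n<N. (cmod (p n))\<^sup>2 + (cmod (diffs b n))\<^sup>2)"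
      by (intro sum_mono2) auto
    also have "\<dots> \<le> lam\<^sup>2" by (rule bessel)
    finally show ?thesis .
  qed
  with ex show ?thesis using that by blast
qed

text \<open>The arithmetic-geometric mean inequality \<open>|x y| \<le> (|x|\<^sup>2 + |y|\<^sup>2) / 2\<close> makes quadratic bounds for
  two coefficient sequences into a linear bound for their product.\<close>

lemma product_coefficients_bound:
  fixes a b A B :: "nat \<Rightarrow> complex"
  assumes "(\<Sum>n\<in>I. w n * ((cmod (a n))\<^sup>2 + (cmod (b n))\<^sup>2)) \<le> C"
    and "(\<Sum>n\<in>I. w n * ((cmod (A n))\<^sup>2 + (cmod (B n))\<^sup>2)) \<le> C"
    and "\<And>n. n \<in> I \<Longrightarrow> 0 \<le> w n"
  shows "(\<Sum>n\<in>I. w n * (cmod (a n * A n) + cmod (b n * B n))) \<le> C"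
proof -
  have "(\<Sum>n\<in>I. w n * (cmod (a n * A n) + cmod (b n * B n)))
      \<le> (\<Sum>n\<in>I. (w n * ((cmod (a n))\<^sup>2 + (cmod (b n))\<^sup>2) + w n * ((cmod (A n))\<^sup>2 + (cmod (B n))\<^sup>2)) / 2)"
  proof (rule sum_mono)
    fix n assume n: "n \<in> I"
    have am_gm: "x * y \<le> (x\<^sup>2 + y\<^sup>2) / 2" for x y :: real
      using sum_squares_bound[of x y] by simp
    have "cmod (a n * A n) + cmod (b n * B n)
        \<le> ((cmod (a n))\<^sup>2 + (cmod (A n))\<^sup>2) / 2 + ((cmod (b n))\<^sup>2 + (cmod (B n))\<^sup>2) / 2"
      unfolding norm_mult by (intro add_mono am_gm)
    then have "w n * (cmod (a n * A n) + cmod (b n * B n))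
        \<le> w n * (((cmod (a n))\<^sup>2 + (cmod (A n))\<^sup>2) / 2 + ((cmod (b n))\<^sup>2 + (cmod (B n))\<^sup>2) / 2)"
      by (rule mult_left_mono) (rule assms(3)[OF n])
    then show "w n * (cmod (a n * A n) + cmod (b n * B n))
        \<le> (w n * ((cmod (a n))\<^sup>2 + (cmod (b n))\<^sup>2) + w n * ((cmod (A n))\<^sup>2 + (cmod (B n))\<^sup>2)) / 2"
      by (simp add: field_simps)
  qed
  also have "\<dots> \<le> C"
    using assms(1,2) by (simp add: sum.distrib flip: sum_divide_distrib)
  finally show ?thesis .
qed

lemma disc_summable_of_bounded_sums:
  assumes "\<And>N. (\<Sum>n=2..N. cmod (c n)) \<le> C"
  shows "disc_summable c"
proof -
  have "summable (\<lambda>n. cmod (c n))"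
  proof (rule bounded_imp_summable)
    fix N
    have "(\<Sum>n\<le>N. cmod (c n)) \<le> (\<Sum>n\<in>{0, 1} \<union> {2..N}. cmod (c n))"
      by (intro sum_mono2) auto
    also have "\<dots> = cmod (c 0) + cmod (c 1) + (\<Sum>n=2..N. cmod (c n))"
      by (subst sum.union_disjoint) auto
    finally show "(\<Sum>n\<le>N. cmod (c n)) \<le> cmod (c 0) + cmod (c 1) + C" using assms[of N] by linarith
  qed simp
  moreover have "cmod (c n * z ^ n) \<le> cmod (c n)" if "z \<in> unit_disc" for z n
    unfolding norm_mult norm_power using that
    by (intro mult_left_le power_le_one) auto
  ultimately show ?thesis
    unfolding disc_summable_def by (auto intro: summable_comparison_test')
qed

text \<open>The estimate is made for a whole list of series at once, since the hypothesis only controls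
  their coefficients jointly.\<close>

lemma power_sums_bound:
  assumes summable: "\<And>p. p \<in> set ps \<Longrightarrow> disc_summable p"
    and low: "\<And>p n. p \<in> set ps \<Longrightarrow> n < k \<Longrightarrow> p n = 0"
    and bound: "\<And>N. (\<Sum>n<N. \<Sum>p\<leftarrow>ps. cmod (p n)) \<le> C"
    and z: "z \<in> unit_disc"
  shows "(\<Sum>p\<leftarrow>ps. cmod (power_sum p z)) \<le> cmod z ^ k * C"
proof -
  have "(\<lambda>N. \<Sum>p\<leftarrow>ps. cmod (\<Sum>n<N. p n * z ^ n)) \<longlonglongrightarrow> (\<Sum>p\<leftarrow>ps. cmod (power_sum p z))"
    using summable
  proof (induction ps)
    case (Cons p ps)
    have "(\<lambda>N. \<Sum>n<N. p n * z ^ n) \<longlonglongrightarrow> power_sum p z"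
      using disc_summableD[OF Cons.prems[of p] z] by (simp add: sums_def)
    then show ?case using Cons by (auto intro!: tendsto_add tendsto_norm)
  qed simp
  moreover have "(\<Sum>p\<leftarrow>ps. cmod (\<Sum>n<N. p n * z ^ n)) \<le> cmod z ^ k * C" for N
  proof -
    have "(\<Sum>p\<leftarrow>ps. cmod (\<Sum>n<N. p n * z ^ n)) \<le> (\<Sum>p\<leftarrow>ps. cmod z ^ k * (\<Sum>n<N. cmod (p n)))"
    proof (rule sum_list_mono)
      fix p assume p: "p \<in> set ps"
      have "cmod (\<Sum>n<N. p n * z ^ n) \<le> (\<Sum>n<N. cmod z ^ k * cmod (p n))"
      proof (rule sum_norm_le)
        fix n
        show "cmod (p n * z ^ n) \<le> cmod z ^ k * cmod (p n)"
        proof (cases "n < k")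
          case False
          then have "cmod z ^ n \<le> cmod z ^ k" using z by (intro power_decreasing) auto
          then show ?thesis
            unfolding norm_mult norm_power by (subst mult.commute) (rule mult_right_mono, auto)
        qed (simp add: low[OF p])
      qed
      then show "cmod (\<Sum>n<N. p n * z ^ n) \<le> cmod z ^ k * (\<Sum>n<N. cmod (p n))"
        by (simp add: sum_distrib_left)
    qed
    also have "\<dots> = cmod z ^ k * (\<Sum>n<N. \<Sum>p\<leftarrow>ps. cmod (p n))"
      by (induction ps) (simp_all add: sum.distrib distrib_left)
    also have "\<dots> \<le> cmod z ^ k * C" by (intro mult_left_mono bound) auto
    finally show ?thesis .
  qed
  ultimately show ?thesis by (blast intro: Lim_bounded)
qed

lemma power_sum_linear:
  assumes "disc_summable a" "disc_summable b"
  shows "disc_summable (\<lambda>n. x * a n + y * b n)"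
    and "z \<in> unit_disc \<Longrightarrow> power_sum (\<lambda>n. x * a n + y * b n) z = x * power_sum a z + y * power_sum b z"
proof -
  have *: "(\<lambda>n. (x * a n + y * b n) * z ^ n) sums (x * power_sum a z + y * power_sum b z)"
    if "z \<in> unit_disc" for z
    using sums_add[OF sums_mult[OF disc_summableD[OF assms(1) that], of x]
        sums_mult[OF disc_summableD[OF assms(2) that], of y]]
    by (simp add: algebra_simps)
  show "disc_summable (\<lambda>n. x * a n + y * b n)"
    unfolding disc_summable_def using * sums_summable by blast
  show "power_sum (\<lambda>n. x * a n + y * b n) z = x * power_sum a z + y * power_sum b z"
    if "z \<in> unit_disc"
    unfolding power_sum_def[of "\<lambda>n. x * a n + y * b n"] using *[OF that] sums_unique by metis
qed

lemma power_sum_quadratic: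
  assumes "\<And>n. 2 < n \<Longrightarrow> a n = 0"
  shows "disc_summable a" and "power_sum a z = a 0 + a 1 * z + a 2 * z\<^sup>2"
proof -
  have *: "(\<lambda>n. a n * z ^ n) sums (a 0 + a 1 * z + a 2 * z\<^sup>2)" for z
    using sums_finite[of "{..2}" "\<lambda>n. a n * z ^ n"] assms by (simp add: numeral_2_eq_2)
  show "disc_summable a" unfolding disc_summable_def using * sums_summable by blast
  show "power_sum a z = a 0 + a 1 * z + a 2 * z\<^sup>2"
    unfolding power_sum_def using * sums_unique by metis
qed

section \<open>The angular derivative of a harmonic series\<close>

text \<open>If \<open>f = h + cnj g\<close> is the series with coefficients \<open>c, d\<close>, this is \<open>z h' - cnj (z g')\<close>, that is,
  \<open>-\<i>\<close> times the derivative of \<open>f (r e\<^sup>i\<^sup>t)\<close> with respect to \<open>t\<close>. Being itself a harmonic series, it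
  can be differentiated along the circle again.\<close>

definition angular_series :: "(nat \<Rightarrow> complex) \<Rightarrow> (nat \<Rightarrow> complex) \<Rightarrow> complex \<Rightarrow> complex" where
  "angular_series c d = harmonic_series (\<lambda>n. of_nat n * c n) (\<lambda>n. - (of_nat n * d n))"

lemma angular_disc_summable:
  assumes "disc_summable c"
  shows "disc_summable (\<lambda>n. of_nat n * c n)" "disc_summable (\<lambda>n. - (of_nat n * c n))"
  using index_mult_series(1)[OF assms] by (auto simp: disc_summable_def intro: summable_minus)

lemma circle_curve_has_vector_derivative:
  assumes c: "disc_summable c" and d: "disc_summable d" and r: "0 < r" "r < 1"
  shows "(circle_curve (harmonic_series c d) r has_vector_derivative
           \<i> * circle_curve (angular_series c d) r t) (at t)"
proof -
  let ?z = "\<lambda>t. of_real r * cis t"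
  have z: "?z t \<in> unit_disc" using r by (simp add: norm_mult)
  have "(cis has_vector_derivative (\<i> * cis t)) (at t)"
    using has_derivative_cis[of "\<lambda>x. x" "\<lambda>x. x" t UNIV] by (simp add: has_vector_derivative_def)
  then have "(?z has_vector_derivative (of_real r * (\<i> * cis t))) (at t)"
    by (auto intro!: derivative_eq_intros)
  from vector_derivative_diff_chain_within[OF this
      has_derivative_at_withinI[OF harmonic_series_wirtinger(3)[OF c d z]]]
  have "(circle_curve (harmonic_series c d) r has_vector_derivative
      \<i> * (?z t * power_sum (diffs c) (?z t)) + cnj (\<i> * (?z t * power_sum (diffs d) (?z t)))) (at t)"
    by (simp add: o_def circle_curve_def[abs_def] mult_ac)
  moreover have "\<i> * (?z t * power_sum (diffs c) (?z t)) + cnj (\<i> * (?z t * power_sum (diffs d) (?z t)))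
      = \<i> * circle_curve (angular_series c d) r t"
  proof -
    have "power_sum (\<lambda>n. - (of_nat n * d n)) (?z t) = - power_sum (\<lambda>n. of_nat n * d n) (?z t)"
      using power_sum_linear(2)[OF angular_disc_summable(1)[OF d] angular_disc_summable(1)[OF d] z, of "-1" 0]
      by simp
    then show ?thesis
      using index_mult_series(2)[OF c z] index_mult_series(2)[OF d z]
      by (simp add: circle_curve_def angular_series_def harmonic_series_eq algebra_simps)
  qed
  ultimately show ?thesis by simp
qed

lemma circle_curve_arg_derivative:
  assumes c: "disc_summable c" and d: "disc_summable d" and r: "0 < r" "r < 1"
    and nz: "harmonic_series c d (of_real r * cis t) \<noteq> 0"
  shows "has_arg_derivative (circle_curve (harmonic_series c d) r) s t \<longleftrightarrow>
     s = Re (angular_series c d (of_real r * cis t) / harmonic_series c d (of_real r * cis t))"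
  using has_arg_derivative_iff[OF circle_curve_has_vector_derivative[OF c d r]] nz
  by (simp add: circle_curve_def flip: times_divide_eq_right)

lemma circle_tangent_eq:
  assumes "disc_summable c" "disc_summable d" "0 < r" "r < 1"
  shows "circle_tangent (harmonic_series c d) r = (\<lambda>t. \<i> * circle_curve (angular_series c d) r t)"
  unfolding circle_tangent_def using circle_curve_has_vector_derivative[OF assms]
  by (auto intro: vector_derivative_at)

text \<open>The tangent is \<open>\<i>\<close> times the angular derivative, and a constant factor does not change the
  derivative of the argument; so this is the formula for image curves, one derivative higher.\<close>

lemma circle_tangent_arg_derivative:
  fixes c d
  defines "c' \<equiv> \<lambda>n. of_nat n * c n" and "d' \<equiv> \<lambda>n. - (of_nat n * d n)"
  assumes c: "disc_summable c" and d: "disc_summable d" and r: "0 < r" "r < 1"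
    and nz: "angular_series c d (of_real r * cis t) \<noteq> 0"
  shows "has_arg_derivative (circle_tangent (harmonic_series c d) r) s t \<longleftrightarrow>
     s = Re (angular_series c' d' (of_real r * cis t) / angular_series c d (of_real r * cis t))"
proof -
  have "(circle_curve (angular_series c d) r has_vector_derivative
           \<i> * circle_curve (angular_series c' d') r t) (at t)"
    unfolding angular_series_def[of c d] c'_def d'_def
    by (rule circle_curve_has_vector_derivative[OF angular_disc_summable(1)[OF c] angular_disc_summable(2)[OF d] r])
  then have "((\<lambda>t. \<i> * circle_curve (angular_series c d) r t) has_vector_derivative
           \<i> * (\<i> * circle_curve (angular_series c' d') r t)) (at t)"
    by (rule has_vector_derivative_mult_right)
  note iff = has_arg_derivative_iff[OF this]
  have "\<i> * (\<i> * w) / (\<i> * v) = \<i> * (w / v)" for v w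
    by (cases "v = 0") (simp_all add: field_simps)
  then have "Im (\<i> * (\<i> * w) / (\<i> * v)) = Re (w / v)" for v w
    by (metis Im_i_times)
  note iff = iff[unfolded this]
  show ?thesis
    unfolding circle_tangent_eq[OF c d r] using iff nz by (simp add: circle_curve_def)
qed

section \<open>Coefficient conditions for starlikeness, convexity and membership\<close>

text \<open>For \<open>q = w / f\<close> the hypothesis says that \<open>q\<close> is closer to \<open>1\<close> than to \<open>2\<alpha> - 1\<close>, and the
  perpendicular bisector of these two points is the line \<open>Re q = \<alpha>\<close>.\<close>

lemma Re_quotient_gt_of_norm_less:
  fixes w f :: complex
  assumes less: "cmod (w - f) < cmod (w + of_real (1 - 2 * \<alpha>) * f)" and \<alpha>: "\<alpha> < 1"
  shows "f \<noteq> 0" and "Re (w / f) > \<alpha>"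
proof -
  show f: "f \<noteq> 0" using less by auto
  define q where "q = w / f"
  have w: "w = q * f" using f by (simp add: q_def)
  have "cmod ((q - 1) * f) < cmod ((q + of_real (1 - 2 * \<alpha>)) * f)"
    using less unfolding w by (simp add: algebra_simps)
  then have "cmod (q - 1) < cmod (q + of_real (1 - 2 * \<alpha>))"
    using f by (simp add: norm_mult)
  then have "(cmod (q - 1))\<^sup>2 < (cmod (q + of_real (1 - 2 * \<alpha>)))\<^sup>2"
    by (intro power_strict_mono) auto
  then have "(Re q - 1)\<^sup>2 < (Re q + (1 - 2 * \<alpha>))\<^sup>2" by (simp add: cmod_power2)
  then have "0 < (1 - \<alpha>) * (Re q - \<alpha>)" by (simp add: power2_eq_square algebra_simps)
  then show "Re (w / f) > \<alpha>" using \<alpha> by (simp add: q_def zero_less_mult_iff)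
qed

text \<open>In \<open>w - f\<close> the term \<open>z\<close> cancels, while \<open>w + (1 - 2\<alpha>) f\<close> contains \<open>2 (1 - \<alpha>) z\<close>. The absolute values
  of all remaining coefficients add up to twice the sum in the hypothesis, so these terms together
  are at most \<open>2 (1 - \<alpha>) |z|\<^sup>2\<close>, which is strictly less than \<open>2 (1 - \<alpha>) |z|\<close>.\<close>

lemma coefficient_condition_starlike:
  assumes c: "disc_summable c" "c 0 = 0" "c 1 = 1" and d: "disc_summable d" "d 0 = 0" "d 1 = 0"
    and \<alpha>: "0 \<le> \<alpha>" "\<alpha> < 1"
    and bound: "\<And>N. (\<Sum>n=2..N. (n - \<alpha>) * cmod (c n) + (n + \<alpha>) * cmod (d n)) \<le> 1 - \<alpha>"
    and z: "z \<in> unit_disc" "z \<noteq> 0"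
  shows "harmonic_series c d z \<noteq> 0" and "Re (angular_series c d z / harmonic_series c d z) > \<alpha>"
proof -
  let ?f = "harmonic_series c d z" and ?w = "angular_series c d z"
  define \<kappa> :: complex where "\<kappa> = of_real (1 - 2 * \<alpha>)"
  define e :: "nat \<Rightarrow> complex" where "e n = (if n = 1 then 1 else 0)" for n
  let ?nc = "\<lambda>n. of_nat n * c n" and ?nd = "\<lambda>n. of_nat n * d n"
  \<comment> \<open>\<open>w - f\<close> is \<open>p1 - cnj q1\<close>, and \<open>w + (1 - 2\<alpha>) f\<close> is \<open>2 (1 - \<alpha>) z + p2 - cnj q2\<close>\<close>
  define p1 where "p1 = (\<lambda>n. 1 * ?nc n + (-1) * c n)"
  define q1 where "q1 = (\<lambda>n. 1 * ?nd n + 1 * d n)"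
  define p2 where "p2 = (\<lambda>n. 1 * (1 * ?nc n + \<kappa> * c n) + (- (1 + \<kappa>)) * e n)"
  define q2 where "q2 = (\<lambda>n. 1 * ?nd n + (- \<kappa>) * d n)"
  have e: "disc_summable e" "power_sum e z = z"
    using power_sum_quadratic[of e] by (simp_all add: e_def)
  note sc = angular_disc_summable(1)[OF c(1)] and sd = angular_disc_summable(1)[OF d(1)]
  note lin = power_sum_linear[OF sc c(1)] power_sum_linear[OF sd d(1)]
    power_sum_linear[OF power_sum_linear(1)[OF sc c(1)] e(1)]
  have summable: "disc_summable p1" "disc_summable q1" "disc_summable p2" "disc_summable q2"
    unfolding p1_def q1_def p2_def q2_def by (intro lin)+
  have f: "?f = power_sum c z + cnj (power_sum d z)" by (rule harmonic_series_eq)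
  have w: "?w = power_sum ?nc z - cnj (power_sum ?nd z)"
    using power_sum_linear(2)[OF sd sd z(1), of "-1" 0]
    by (simp add: angular_series_def harmonic_series_eq)
  have minus: "?w - ?f = power_sum p1 z - cnj (power_sum q1 z)"
    unfolding p1_def q1_def lin(2)[OF z(1)] lin(4)[OF z(1)] f w by simp
  have plus: "?w + \<kappa> * ?f - (1 + \<kappa>) * z = power_sum p2 z - cnj (power_sum q2 z)"
    unfolding p2_def q2_def lin(2)[OF z(1)] lin(4)[OF z(1)] lin(6)[OF z(1)] e(2) f w
    by (simp add: algebra_simps \<kappa>_def)
  have low: "p n = 0" if "p \<in> set [p1, q1, p2, q2]" "n < 2" for p n
  proof -
    have "n = 0 \<or> n = 1" using that(2) by auto
    then show ?thesis using that(1) c d by (auto simp: p1_def q1_def p2_def q2_def e_def)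
  qed
  have weights: "(\<Sum>p\<leftarrow>[p1, q1, p2, q2]. cmod (p n)) = 2 * ((n - \<alpha>) * cmod (c n) + (n + \<alpha>) * cmod (d n))"
    if n: "2 \<le> n" for n
  proof -
    have "p1 n = of_real (real n - 1) * c n" "q1 n = of_real (real n + 1) * d n"
      "p2 n = of_real (real n + 1 - 2 * \<alpha>) * c n" "q2 n = of_real (real n - 1 + 2 * \<alpha>) * d n"
      using n by (auto simp: p1_def q1_def p2_def q2_def e_def \<kappa>_def algebra_simps)
    then have "(\<Sum>p\<leftarrow>[p1, q1, p2, q2]. cmod (p n)) =
        \<bar>real n - 1\<bar> * cmod (c n) + \<bar>real n + 1\<bar> * cmod (d n)
        + \<bar>real n + 1 - 2 * \<alpha>\<bar> * cmod (c n) + \<bar>real n - 1 + 2 * \<alpha>\<bar> * cmod (d n)"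
      by (simp add: norm_mult del: of_real_add of_real_diff of_real_mult)
    also have "\<dots> = 2 * ((n - \<alpha>) * cmod (c n) + (n + \<alpha>) * cmod (d n))"
      using n \<alpha> by (simp add: algebra_simps)
    finally show ?thesis .
  qed
  have "(\<Sum>p\<leftarrow>[p1, q1, p2, q2]. cmod (power_sum p z)) \<le> cmod z ^ 2 * (2 * (1 - \<alpha>))"
  proof (rule power_sums_bound)
    show "p n = 0" if "p \<in> set [p1, q1, p2, q2]" "n < 2" for p n using low that .
    fix N
    have "(\<Sum>n<N. \<Sum>p\<leftarrow>[p1, q1, p2, q2]. cmod (p n)) \<le> (\<Sum>n\<le>N. \<Sum>p\<leftarrow>[p1, q1, p2, q2]. cmod (p n))"
      by (intro sum_mono2) auto
    also have "\<dots> = (\<Sum>n=2..N. \<Sum>p\<leftarrow>[p1, q1, p2, q2]. cmod (p n))"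
      using low[of p1] low[of q1] low[of p2] low[of q2]
      by (intro sum.mono_neutral_right) (auto simp: not_le)
    also have "\<dots> = 2 * (\<Sum>n=2..N. (n - \<alpha>) * cmod (c n) + (n + \<alpha>) * cmod (d n))"
      unfolding sum_distrib_left using weights by (intro sum.cong) auto
    also have "\<dots> \<le> 2 * (1 - \<alpha>)" using bound[of N] by simp
    finally show "(\<Sum>n<N. \<Sum>p\<leftarrow>[p1, q1, p2, q2]. cmod (p n)) \<le> 2 * (1 - \<alpha>)" .
  qed (use summable z in auto)
  then have "cmod (?w - ?f) + cmod (?w + \<kappa> * ?f - (1 + \<kappa>) * z) \<le> cmod z ^ 2 * (2 * (1 - \<alpha>))"
    unfolding minus plus
    using norm_triangle_ineq4[of "power_sum p1 z" "cnj (power_sum q1 z)"]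
      norm_triangle_ineq4[of "power_sum p2 z" "cnj (power_sum q2 z)"] by simp
  also have "\<dots> < cmod z * (2 * (1 - \<alpha>))"
    using z \<alpha> by (intro mult_strict_right_mono) (auto simp: power2_eq_square)
  also have "\<dots> = cmod ((1 + \<kappa>) * z)"
  proof -
    have "1 + \<kappa> = of_real (2 * (1 - \<alpha>))" by (simp add: \<kappa>_def)
    then show ?thesis using \<alpha> by (simp add: norm_mult del: of_real_mult of_real_diff)
  qed
  also have "\<dots> \<le> cmod (?w + \<kappa> * ?f - (1 + \<kappa>) * z) + cmod (?w + \<kappa> * ?f)"
    using norm_triangle_sub[of "(1 + \<kappa>) * z" "?w + \<kappa> * ?f"] by (simp add: norm_minus_commute)
  finally have "cmod (?w - ?f) < cmod (?w + \<kappa> * ?f)" by linarith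
  from Re_quotient_gt_of_norm_less[OF this[unfolded \<kappa>_def] \<alpha>(2)]
  show "harmonic_series c d z \<noteq> 0" "Re (angular_series c d z / harmonic_series c d z) > \<alpha>" .
qed

lemma harmonic_series_normalised:
  assumes c: "disc_summable c" "c 0 = 0" "c 1 = 1" and d: "disc_summable d" "d 0 = 0" "d 1 = 0"
  shows "harmonic_on (harmonic_series c d) unit_disc" "harmonic_series c d 0 = 0"
    "dz (harmonic_series c d) 0 = 1" "dzbar (harmonic_series c d) 0 = 0"
  using harmonic_series_harmonic[OF c(1) d(1)] harmonic_series_wirtinger(1,2)[OF c(1) d(1), of 0] c d
  by (simp_all add: harmonic_series_eq power_sum_zero diffs_def)

lemma starlike_of_order_harmonic_series:
  assumes c: "disc_summable c" "c 0 = 0" "c 1 = 1" and d: "disc_summable d" "d 0 = 0" "d 1 = 0"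
    and \<alpha>: "0 \<le> \<alpha>" "\<alpha> < 1"
    and bound: "\<And>N. (\<Sum>n=2..N. (n - \<alpha>) * cmod (c n) + (n + \<alpha>) * cmod (d n)) \<le> 1 - \<alpha>"
  shows "starlike_of_order \<alpha> (harmonic_series c d)"
  unfolding starlike_of_order_def
proof (intro conjI allI impI)
  fix r t :: real assume "0 < r \<and> r < 1 \<and> 0 \<le> t \<and> t \<le> 2 * pi"
  then have r: "0 < r" "r < 1" by auto
  have z: "of_real r * cis t \<in> unit_disc" "of_real r * cis t \<noteq> 0"
    using r by (auto simp: norm_mult)
  note * = coefficient_condition_starlike[OF c d \<alpha> bound z]
  show "\<exists>s. has_arg_derivative (circle_curve (harmonic_series c d) r) s t \<and> \<alpha> < s"
    using circle_curve_arg_derivative[OF c(1) d(1) r *(1)] *(2) by blast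
qed (use harmonic_series_normalised[OF c d] in auto)

text \<open>Convexity of a mapping is starlikeness of its angular derivative, whose coefficients carry the
  additional factor \<open>n\<close>.\<close>

lemma convex_of_order_harmonic_series:
  assumes c: "disc_summable c" "c 0 = 0" "c 1 = 1" and d: "disc_summable d" "d 0 = 0" "d 1 = 0"
    and \<beta>: "0 \<le> \<beta>" "\<beta> < 1"
    and bound: "\<And>N. (\<Sum>n=2..N. n * (n - \<beta>) * cmod (c n) + n * (n + \<beta>) * cmod (d n)) \<le> 1 - \<beta>"
  shows "convex_of_order \<beta> (harmonic_series c d)"
  unfolding convex_of_order_def
proof (intro conjI allI impI)
  fix r t :: real assume "0 < r \<and> r < 1 \<and> 0 \<le> t \<and> t \<le> 2 * pi"
  then have r: "0 < r" "r < 1" by auto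
  let ?c = "\<lambda>n. of_nat n * c n" and ?d = "\<lambda>n. - (of_nat n * d n)"
  have z: "of_real r * cis t \<in> unit_disc" "of_real r * cis t \<noteq> 0"
    using r by (auto simp: norm_mult)
  have "(\<Sum>n=2..N. (n - \<beta>) * cmod (?c n) + (n + \<beta>) * cmod (?d n)) \<le> 1 - \<beta>" for N
    using bound[of N] by (simp add: norm_mult mult_ac)
  note * = coefficient_condition_starlike[OF angular_disc_summable(1)[OF c(1)] _ _
      angular_disc_summable(2)[OF d(1)] _ _ \<beta> this z, folded angular_series_def[of c d]]
  show "\<exists>s. has_arg_derivative (circle_tangent (harmonic_series c d) r) s t \<and> \<beta> < s"
    using circle_tangent_arg_derivative[OF c(1) d(1) r *(1)] *(2) c d by simp
qed (use harmonic_series_normalised[OF c d] in auto)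

lemma FH0_harmonic_series:
  assumes c: "disc_summable c" "c 0 = 0" "c 1 = 1" and d: "disc_summable d" "d 0 = 0" "d 1 = 0"
    and bound: "\<And>N. (\<Sum>n=2..N. n * (cmod (c n) + cmod (d n))) \<le> \<mu>" and \<mu>: "0 < \<mu>"
  shows "harmonic_series c d \<in> FH0 \<mu>"
  unfolding FH0_def
proof (intro CollectI conjI ballI)
  fix z :: complex assume z: "z \<in> unit_disc"
  define e :: "nat \<Rightarrow> complex" where "e n = (if n = 0 then 1 else 0)" for n
  define p where "p = (\<lambda>n. 1 * diffs c n + (-1) * e n)"
  have e: "disc_summable e" "power_sum e z = 1"
    using power_sum_quadratic[of e] by (simp_all add: e_def)
  note lin = power_sum_linear[OF disc_summable_diffs[OF c(1)] e(1)]
  have "(\<Sum>q\<leftarrow>[p, diffs d]. cmod (power_sum q z)) \<le> cmod z ^ 1 * \<mu>"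
  proof (rule power_sums_bound)
    show "disc_summable q" if "q \<in> set [p, diffs d]" for q
      using that d disc_summable_diffs lin(1)[of 1 "-1"] by (auto simp: p_def)
    show "q n = 0" if "q \<in> set [p, diffs d]" "n < 1" for q n
      using that c d by (auto simp: p_def e_def diffs_def)
    fix N
    let ?g = "\<lambda>n. n * (cmod (c n) + cmod (d n))"
    have "(\<Sum>n<N. \<Sum>q\<leftarrow>[p, diffs d]. cmod (q n)) = (\<Sum>n<N. if n = 0 then 0 else ?g (Suc n))"
      using c(3) d(3)
      by (intro sum.cong) (auto simp: p_def e_def diffs_def norm_mult distrib_left simp del: of_nat_Suc)
    also have "\<dots> = (\<Sum>n=1..<N. ?g (Suc n))"
      by (rule sum.mono_neutral_cong_right) auto
    also have "\<dots> = (\<Sum>n=2..N. ?g n)"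
      using sum.shift_bounds_Suc_ivl[of ?g 1 N]
      by (simp add: atLeastLessThanSuc_atLeastAtMost numeral_2_eq_2)
    also have "\<dots> \<le> \<mu>" by (rule bound)
    finally show "(\<Sum>n<N. \<Sum>q\<leftarrow>[p, diffs d]. cmod (q n)) \<le> \<mu>" .
  qed (rule z)
  also have "\<dots> < 1 * \<mu>" using z \<mu> by (intro mult_strict_right_mono) auto
  finally have "cmod (power_sum p z) + cmod (power_sum (diffs d) z) < \<mu>" by simp
  then show "cmod (dz (harmonic_series c d) z - 1) < \<mu> - cmod (dzbar (harmonic_series c d) z)"
    using harmonic_series_wirtinger(1,2)[OF c(1) d(1) z] lin(2)[OF z, of 1 "-1"] e(2)
    by (simp add: p_def)
qed (use harmonic_series_normalised[OF c d] in auto)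

section \<open>Quadratic mappings and their orders\<close>

text \<open>The mapping \<open>z + x z\<^sup>2 + cnj (y z\<^sup>2)\<close>, given through its coefficients so that convolutions and
  angular derivatives of such mappings can be read off.\<close>

definition quadratic_mapping :: "complex \<Rightarrow> complex \<Rightarrow> complex \<Rightarrow> complex" where
  "quadratic_mapping x y = harmonic_series
     (\<lambda>n. if n = 1 then 1 else if n = 2 then x else 0) (\<lambda>n. if n = 2 then y else 0)"

lemma quadratic_disc_summable:
  "disc_summable (\<lambda>n. if n = 1 then 1 else if n = 2 then x else 0)"
  "disc_summable (\<lambda>n. if n = 2 then y else 0)"
  by (auto intro: power_sum_quadratic(1))

lemma quadratic_mapping_eq: "quadratic_mapping x y z = z + x * z\<^sup>2 + cnj (y * z\<^sup>2)"
  unfolding quadratic_mapping_def harmonic_series_eq by (simp add: power_sum_quadratic(2))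

lemma quadratic_mapping_expansion:
  "harmonic_expansion (quadratic_mapping x y)
     (\<lambda>n. if n = 1 then 1 else if n = 2 then x else 0) (\<lambda>n. if n = 2 then y else 0)"
  unfolding harmonic_expansion_alt using quadratic_disc_summable
  by (simp add: quadratic_mapping_def)

lemma quadratic_mapping_dz:
  assumes "z \<in> unit_disc"
  shows "dz (quadratic_mapping x y) z = 1 + 2 * x * z"
  unfolding harmonic_expansion_wirtinger(1)[OF quadratic_mapping_expansion assms]
  by (subst power_sum_quadratic(2)) (auto simp: diffs_def)

lemma quadratic_mapping_FH0:
  assumes "2 * (cmod x + cmod y) \<le> lam" "0 < lam"
  shows "quadratic_mapping x y \<in> FH0 lam"
  unfolding quadratic_mapping_def
proof (rule FH0_harmonic_series)
  fix N
  let ?c = "\<lambda>n. if n = 1 then 1 else if n = 2 then x else 0"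
    and ?d = "\<lambda>n::nat. if n = 2 then y else 0"
  have "(\<Sum>n=2..N. n * (cmod (?c n) + cmod (?d n))) = (\<Sum>n=2..N. if n = 2 then 2 * (cmod x + cmod y) else 0)"
    by (intro sum.cong) auto
  also have "\<dots> \<le> lam" using assms by simp
  finally show "(\<Sum>n=2..N. n * (cmod (?c n) + cmod (?d n))) \<le> lam" .
qed (use assms quadratic_disc_summable in auto)

lemma quadratic_mapping_hconv:
  "quadratic_mapping x y \<star> quadratic_mapping x' y' = quadratic_mapping (x * x') (y * y')"
  unfolding hconv_eq_harmonic_series[OF quadratic_mapping_expansion quadratic_mapping_expansion]
  unfolding quadratic_mapping_def
  by (intro arg_cong2[where f = harmonic_series]) auto

text \<open>At \<open>z = r\<close> the derivative of the argument is \<open>(1 - 2 y r) / (1 + y r)\<close>; let \<open>r \<rightarrow> 1\<close>.\<close>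

lemma starlike_order_quadratic_le:
  fixes y :: real
  assumes y: "0 \<le> y" and starlike: "starlike_of_order \<beta> (quadratic_mapping 0 (of_real y))"
  shows "\<beta> \<le> (1 - 2 * y) / (1 + y)"
proof -
  let ?d = "\<lambda>n::nat. if n = 2 then complex_of_real y else 0"
    and ?c = "\<lambda>n::nat. if n = 1 then 1 else if n = 2 then 0 else 0 :: complex"
  have ang: "angular_series ?c ?d = quadratic_mapping 0 (of_real (- 2 * y))"
    unfolding angular_series_def quadratic_mapping_def
    by (intro arg_cong2[where f = harmonic_series]) auto
  have below: "\<beta> \<le> (1 - 2 * y * r) / (1 + y * r)" if r: "0 < r" "r < 1" for r
  proof -
    obtain s where s: "has_arg_derivative (circle_curve (harmonic_series ?c ?d) r) s 0" "\<beta> < s"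
      using starlike r unfolding starlike_of_order_def quadratic_mapping_def by fastforce
    have f: "harmonic_series ?c ?d (of_real r * cis 0) = of_real (r * (1 + y * r))"
      using quadratic_mapping_eq[of 0 "of_real y" "of_real r"]
      by (simp add: quadratic_mapping_def power2_eq_square algebra_simps)
    have w: "angular_series ?c ?d (of_real r * cis 0) = of_real (r * (1 - 2 * y * r))"
      unfolding ang quadratic_mapping_eq by (simp add: power2_eq_square algebra_simps)
    have pos: "r * (1 + y * r) > 0" using r y by (intro mult_pos_pos add_pos_nonneg) auto
    then have "harmonic_series ?c ?d (of_real r * cis 0) \<noteq> 0"
      unfolding f of_real_eq_0_iff by linarith
    from circle_curve_arg_derivative[OF quadratic_disc_summable r this] s(1)
    have "s = r * (1 - 2 * y * r) / (r * (1 + y * r))"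
      unfolding f w by (simp flip: of_real_divide del: of_real_mult)
    then show ?thesis using s(2) r by simp
  qed
  have "((\<lambda>r. (1 - 2 * y * r) / (1 + y * r)) \<longlongrightarrow> (1 - 2 * y * 1) / (1 + y * 1)) (at_left 1)"
    using y by (intro tendsto_intros) auto
  moreover have "\<forall>\<^sub>F r in at_left (1 :: real). \<beta> \<le> (1 - 2 * y * r) / (1 + y * r)"
    using eventually_at_left_real[of 0 1] by (auto elim!: eventually_mono intro!: below)
  ultimately show ?thesis by (auto intro: tendsto_lowerbound)
qed

text \<open>The critical point is now \<open>z = -r\<close>: the coefficient of \<open>cnj z\<^sup>2\<close> in the angular derivative is
  \<open>-2y\<close>, and at negative \<open>z\<close> this term points in the same direction as \<open>z\<close>, while the next angular
  derivative has coefficient \<open>4y\<close>.\<close>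

lemma convex_order_quadratic_le:
  fixes y :: real
  assumes y: "0 \<le> y" and convex: "convex_of_order \<beta> (quadratic_mapping 0 (of_real y))"
  shows "\<beta> \<le> (1 - 4 * y) / (1 + 2 * y)"
proof -
  let ?d = "\<lambda>n::nat. if n = 2 then complex_of_real y else 0"
    and ?c = "\<lambda>n::nat. if n = 1 then 1 else if n = 2 then 0 else 0 :: complex"
  have ang: "angular_series ?c ?d = quadratic_mapping 0 (of_real (- 2 * y))"
    unfolding angular_series_def quadratic_mapping_def
    by (intro arg_cong2[where f = harmonic_series]) auto
  have ang2: "angular_series (\<lambda>n. of_nat n * ?c n) (\<lambda>n. - (of_nat n * ?d n))
      = quadratic_mapping 0 (of_real (4 * y))"
    unfolding angular_series_def quadratic_mapping_def
    by (intro arg_cong2[where f = harmonic_series]) auto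
  have below: "\<beta> \<le> (1 - 4 * y * r) / (1 + 2 * y * r)" if r: "0 < r" "r < 1" for r
  proof -
    have "0 < r \<and> r < 1 \<and> 0 \<le> pi \<and> pi \<le> 2 * pi" using r by simp
    then obtain s where s: "has_arg_derivative (circle_tangent (harmonic_series ?c ?d) r) s pi" "\<beta> < s"
      using convex unfolding convex_of_order_def quadratic_mapping_def by blast
    have f: "angular_series ?c ?d (of_real r * cis pi) = of_real (- r * (1 + 2 * y * r))"
      unfolding ang quadratic_mapping_eq by (simp add: power2_eq_square algebra_simps)
    have w: "angular_series (\<lambda>n. of_nat n * ?c n) (\<lambda>n. - (of_nat n * ?d n)) (of_real r * cis pi)
        = of_real (- r * (1 - 4 * y * r))"
      unfolding ang2 quadratic_mapping_eq by (simp add: power2_eq_square algebra_simps)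
    have "r * (1 + 2 * y * r) > 0" using r y by (intro mult_pos_pos add_pos_nonneg) auto
    then have "angular_series ?c ?d (of_real r * cis pi) \<noteq> 0"
      unfolding f of_real_eq_0_iff by linarith
    from circle_tangent_arg_derivative[OF quadratic_disc_summable r this] s(1)
    have "s = - r * (1 - 4 * y * r) / (- r * (1 + 2 * y * r))"
      unfolding f w by (simp flip: of_real_divide del: of_real_mult)
    then show ?thesis using s(2) r by simp
  qed
  have "((\<lambda>r. (1 - 4 * y * r) / (1 + 2 * y * r)) \<longlongrightarrow> (1 - 4 * y * 1) / (1 + 2 * y * 1)) (at_left 1)"
    using y by (intro tendsto_intros) auto
  moreover have "\<forall>\<^sub>F r in at_left (1 :: real). \<beta> \<le> (1 - 4 * y * r) / (1 + 2 * y * r)"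
    using eventually_at_left_real[of 0 1] by (auto elim!: eventually_mono intro!: below)
  ultimately show ?thesis by (auto intro: tendsto_lowerbound)
qed

section \<open>The convolution theorem\<close>

text \<open>With \<open>(1 - \<alpha>) / L = 3 / (4 + L)\<close> the difference of the two sides is a positive multiple of
  \<open>(x - 2) (3 x + 2 - L)\<close>; equality at \<open>x = 2\<close> is what fixes \<open>\<alpha>\<close>.\<close>

lemma starlike_weight_le:
  fixes x L :: real
  assumes "2 \<le> x" "0 < L" "L \<le> 1" and \<alpha>: "\<alpha> = 2 * (2 - L) / (4 + L)"
  shows "x + \<alpha> \<le> (1 - \<alpha>) / L * x\<^sup>2"
proof -
  have "(1 - \<alpha>) / L = 3 / (4 + L)" using assms by (simp add: field_simps)
  moreover have "(x + \<alpha>) * (4 + L) \<le> 3 * x\<^sup>2"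
  proof -
    have "0 \<le> (x - 2) * (3 * x + 2 - L)" using assms by (intro mult_nonneg_nonneg) auto
    moreover have "\<alpha> * (4 + L) = 2 * (2 - L)" using assms by simp
    ultimately show ?thesis by (simp add: power2_eq_square algebra_simps)
  qed
  ultimately show ?thesis using assms by (simp add: pos_le_divide_eq)
qed

text \<open>With \<open>(1 - \<beta>) / L = 3 / (2 + L)\<close> the difference of the two sides is a positive multiple of
  \<open>x (x - 2) (1 - L)\<close>; equality at \<open>x = 2\<close> is what fixes \<open>\<beta>\<close>.\<close>

lemma convex_weight_le:
  fixes x L :: real
  assumes "2 \<le> x" "0 < L" "L \<le> 1" and \<beta>: "\<beta> = 2 * (1 - L) / (2 + L)"
  shows "x * (x + \<beta>) \<le> (1 - \<beta>) / L * x\<^sup>2"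
proof -
  have "(1 - \<beta>) / L = 3 / (2 + L)" using assms by (simp add: field_simps)
  moreover have "x + \<beta> \<le> 3 / (2 + L) * x"
  proof -
    have "0 \<le> (x - 2) * (1 - L)" using assms by (intro mult_nonneg_nonneg) auto
    moreover have "\<beta> * (2 + L) = 2 * (1 - L)" using assms by simp
    ultimately have "(x + \<beta>) * (2 + L) \<le> 3 * x" by (simp add: algebra_simps)
    then show ?thesis using assms by (simp add: pos_le_divide_eq)
  qed
  then have "x * (x + \<beta>) \<le> x * (3 / (2 + L) * x)" using assms by (intro mult_left_mono) auto
  ultimately show ?thesis by (simp add: power2_eq_square mult_ac)
qed

lemma weighted_sum_le:
  fixes w u v :: "nat \<Rightarrow> real"
  assumes sum: "(\<Sum>n=2..N. (real n)\<^sup>2 * (u n + v n)) \<le> L" and "0 \<le> K"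
    and weight: "\<And>n. 2 \<le> n \<Longrightarrow> w n \<le> K * (real n)\<^sup>2" "\<And>n. 2 \<le> n \<Longrightarrow> w' n \<le> w n"
    and nonneg: "\<And>n. 0 \<le> u n" "\<And>n. 0 \<le> v n"
  shows "(\<Sum>n=2..N. w' n * u n + w n * v n) \<le> K * L"
proof -
  have "(\<Sum>n=2..N. w' n * u n + w n * v n) \<le> (\<Sum>n=2..N. K * ((real n)\<^sup>2 * (u n + v n)))"
  proof (rule sum_mono)
    fix n assume "n \<in> {2..N}"
    then have n: "2 \<le> n" by simp
    have "w' n * u n + w n * v n \<le> w n * (u n + v n)"
      using weight(2)[OF n] nonneg by (simp add: distrib_left mult_right_mono)
    also have "\<dots> \<le> K * (real n)\<^sup>2 * (u n + v n)"
      using weight(1)[OF n] nonneg by (intro mult_right_mono) auto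
    finally show "w' n * u n + w n * v n \<le> K * ((real n)\<^sup>2 * (u n + v n))" by (simp add: mult_ac)
  qed
  also have "\<dots> \<le> K * L" unfolding sum_distrib_left[symmetric] using assms by (intro mult_left_mono) auto
  finally show ?thesis .
qed

text \<open>Every conclusion compares a weight with the \<open>n\<^sup>2\<close> of the linear coefficient bound.\<close>

lemma hconv_FH0:
  assumes lam: "0 < lam" "lam \<le> 1" and f: "f \<in> FH0 lam" and F: "F \<in> FH0 lam"
  shows "f \<star> F \<in> FH0 (lam\<^sup>2 / 2)"
    and "starlike_of_order (2 * (2 - lam\<^sup>2) / (4 + lam\<^sup>2)) (f \<star> F)"
    and "convex_of_order (2 * (1 - lam\<^sup>2) / (2 + lam\<^sup>2)) (f \<star> F)"
proof -
  obtain a b where f_exp: "harmonic_expansion f a b"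
    and ab: "\<And>N. (\<Sum>n=2..N. (real n)\<^sup>2 * ((cmod (a n))\<^sup>2 + (cmod (b n))\<^sup>2)) \<le> lam\<^sup>2"
    using FH0_expansion[OF f] by blast
  obtain A B where F_exp: "harmonic_expansion F A B"
    and AB: "\<And>N. (\<Sum>n=2..N. (real n)\<^sup>2 * ((cmod (A n))\<^sup>2 + (cmod (B n))\<^sup>2)) \<le> lam\<^sup>2"
    using FH0_expansion[OF F] by blast
  define c where "c n = a n * A n" for n
  define d where "d n = b n * B n" for n
  define L where "L = lam\<^sup>2"
  define \<alpha> where "\<alpha> = 2 * (2 - L) / (4 + L)"
  define \<beta> where "\<beta> = 2 * (1 - L) / (2 + L)"
  have L: "0 < L" "L \<le> 1" using lam by (auto simp: L_def power_le_one)
  have conv: "f \<star> F = harmonic_series c d"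
    unfolding hconv_eq_harmonic_series[OF f_exp F_exp] c_def[abs_def] d_def[abs_def] ..
  have init: "c 0 = 0" "c 1 = 1" "d 0 = 0" "d 1 = 0"
    using f_exp F_exp by (auto simp: harmonic_expansion_alt c_def d_def)
  have key: "(\<Sum>n=2..N. (real n)\<^sup>2 * (cmod (c n) + cmod (d n))) \<le> L" for N
    unfolding c_def d_def L_def by (rule product_coefficients_bound[OF ab AB]) simp
  have one: "1 \<le> 1 * (real n)\<^sup>2" if "2 \<le> n" for n
    using that by (simp add: one_le_power)
  have "(\<Sum>n=2..N. 0 * cmod (d n) + 1 * cmod (c n)) \<le> 1 * L"
    "(\<Sum>n=2..N. 0 * cmod (c n) + 1 * cmod (d n)) \<le> 1 * L" for N
    by (rule weighted_sum_le[OF _ _ one]; use key[of N] in \<open>simp add: add.commute\<close>)+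
  then have c: "disc_summable c" and d: "disc_summable d"
    by (auto intro!: disc_summable_of_bounded_sums[of _ L])
  show "f \<star> F \<in> FH0 (lam\<^sup>2 / 2)"
    unfolding conv
  proof (rule FH0_harmonic_series[OF c init(1,2) d init(3,4)])
    fix N
    have "(\<Sum>n=2..N. real n * cmod (c n) + real n * cmod (d n)) \<le> 1 / 2 * L"
      by (rule weighted_sum_le[OF key]) (auto simp: power2_eq_square)
    then show "(\<Sum>n=2..N. n * (cmod (c n) + cmod (d n))) \<le> lam\<^sup>2 / 2"
      by (simp add: L_def distrib_left)
  qed (use lam in auto)
  have \<alpha>: "0 \<le> \<alpha>" "\<alpha> < 1" and \<beta>: "0 \<le> \<beta>" "\<beta> < 1"
    using L by (auto simp: \<alpha>_def \<beta>_def field_simps)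
  show "starlike_of_order (2 * (2 - lam\<^sup>2) / (4 + lam\<^sup>2)) (f \<star> F)"
    unfolding conv L_def[symmetric] \<alpha>_def[symmetric]
  proof (rule starlike_of_order_harmonic_series[OF c init(1,2) d init(3,4) \<alpha>])
    fix N
    have "real n + \<alpha> \<le> (1 - \<alpha>) / L * (real n)\<^sup>2" if "2 \<le> n" for n
      using starlike_weight_le[OF _ L \<alpha>_def, of "real n"] that by simp
    then have "(\<Sum>n=2..N. (n - \<alpha>) * cmod (c n) + (n + \<alpha>) * cmod (d n)) \<le> (1 - \<alpha>) / L * L"
      by (rule weighted_sum_le[OF key, rotated]) (use L \<alpha> in auto)
    then show "(\<Sum>n=2..N. (n - \<alpha>) * cmod (c n) + (n + \<alpha>) * cmod (d n)) \<le> 1 - \<alpha>"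
      using L by simp
  qed
  show "convex_of_order (2 * (1 - lam\<^sup>2) / (2 + lam\<^sup>2)) (f \<star> F)"
    unfolding conv L_def[symmetric] \<beta>_def[symmetric]
  proof (rule convex_of_order_harmonic_series[OF c init(1,2) d init(3,4) \<beta>])
    fix N
    have "n * (n + \<beta>) \<le> (1 - \<beta>) / L * (real n)\<^sup>2" if "2 \<le> n" for n
      using convex_weight_le[OF _ L \<beta>_def, of "real n"] that by simp
    then have "(\<Sum>n=2..N. n * (n - \<beta>) * cmod (c n) + n * (n + \<beta>) * cmod (d n)) \<le> (1 - \<beta>) / L * L"
      by (rule weighted_sum_le[OF key, rotated]) (use L \<beta> in \<open>auto intro: mult_left_mono\<close>)
    then show "(\<Sum>n=2..N. n * (n - \<beta>) * cmod (c n) + n * (n + \<beta>) * cmod (d n)) \<le> 1 - \<beta>"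
      using L by simp
  qed
qed

theorem theorem4p1:
  fixes lam :: real
  assumes "0 < lam" and "lam \<le> 1"
  shows
    "(\<forall>f\<in>FH0 lam. \<forall>F\<in>FH0 lam.
        f \<star> F \<in> FH0 (lam\<^sup>2 / 2) \<and>
        starlike_of_order (2 * (2 - lam\<^sup>2) / (4 + lam\<^sup>2)) (f \<star> F) \<and>
        convex_of_order (2 * (1 - lam\<^sup>2) / (2 + lam\<^sup>2)) (f \<star> F)) \<and>
     (\<forall>\<mu>. 0 < \<mu> \<and> \<mu> < lam\<^sup>2 / 2 \<longrightarrow>
        \<not> (\<forall>f\<in>FH0 lam. \<forall>F\<in>FH0 lam. f \<star> F \<in> FH0 \<mu>)) \<and>
     (\<forall>\<beta>. \<beta> > 2 * (2 - lam\<^sup>2) / (4 + lam\<^sup>2) \<longrightarrow>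
        \<not> (\<forall>f\<in>FH0 lam. \<forall>F\<in>FH0 lam. starlike_of_order \<beta> (f \<star> F))) \<and>
     (\<forall>\<beta>. \<beta> > 2 * (1 - lam\<^sup>2) / (2 + lam\<^sup>2) \<longrightarrow>
        \<not> (\<forall>f\<in>FH0 lam. \<forall>F\<in>FH0 lam. convex_of_order \<beta> (f \<star> F)))"
proof (intro conjI allI impI ballI)
  fix f F assume "f \<in> FH0 lam" "F \<in> FH0 lam"
  then show "f \<star> F \<in> FH0 (lam\<^sup>2 / 2)"
    "starlike_of_order (2 * (2 - lam\<^sup>2) / (4 + lam\<^sup>2)) (f \<star> F)"
    "convex_of_order (2 * (1 - lam\<^sup>2) / (2 + lam\<^sup>2)) (f \<star> F)"
    using hconv_FH0 assms by blast+
next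
  fix \<mu> assume \<mu>: "0 < \<mu> \<and> \<mu> < lam\<^sup>2 / 2"
  let ?q = "quadratic_mapping (of_real (lam / 2)) 0"
  have q: "?q \<in> FH0 lam" using assms by (intro quadratic_mapping_FH0) auto
  \<comment> \<open>the point at which \<open>\<lambda>\<^sup>2 z / 2\<close> equals \<open>\<mu>\<close>\<close>
  define z where "z = complex_of_real (2 * \<mu> / lam\<^sup>2)"
  have z: "z \<in> unit_disc" using \<mu> assms by (simp add: z_def norm_divide norm_mult norm_power)
  have "dz (?q \<star> ?q) z - 1 = of_real \<mu>"
    unfolding quadratic_mapping_hconv quadratic_mapping_dz[OF z]
    using assms by (simp add: z_def power2_eq_square)
  then have "\<not> cmod (dz (?q \<star> ?q) z - 1) < \<mu> - cmod (dzbar (?q \<star> ?q) z)"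
    using \<mu> by simp
  then have "?q \<star> ?q \<notin> FH0 \<mu>" using z unfolding FH0_def by blast
  then show "\<not> (\<forall>f\<in>FH0 lam. \<forall>F\<in>FH0 lam. f \<star> F \<in> FH0 \<mu>)" using q by blast
next
  let ?q = "quadratic_mapping 0 (of_real (lam / 2))"
  have q: "?q \<in> FH0 lam" using assms by (intro quadratic_mapping_FH0) auto
  have qq: "?q \<star> ?q = quadratic_mapping 0 (of_real (lam\<^sup>2 / 4))"
    unfolding quadratic_mapping_hconv by (simp add: power2_eq_square)
  {
    fix \<beta> assume \<beta>: "\<beta> > 2 * (2 - lam\<^sup>2) / (4 + lam\<^sup>2)"
    have "(1 - 2 * (L / 4)) / (1 + L / 4) = 2 * (2 - L) / (4 + L)" if "0 \<le> L" for L :: real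
    proof -
      have "1 + L / 4 \<noteq> 0" "4 + L \<noteq> 0" using that by linarith+
      then show ?thesis by (simp add: field_simps)
    qed
    from this[of "lam\<^sup>2"] have "\<not> starlike_of_order \<beta> (?q \<star> ?q)"
      using starlike_order_quadratic_le[of "lam\<^sup>2 / 4" \<beta>] \<beta> unfolding qq by auto
    then show "\<not> (\<forall>f\<in>FH0 lam. \<forall>F\<in>FH0 lam. starlike_of_order \<beta> (f \<star> F))" using q by blast
  next
    fix \<beta> assume \<beta>: "\<beta> > 2 * (1 - lam\<^sup>2) / (2 + lam\<^sup>2)"
    have "(1 - 4 * (L / 4)) / (1 + 2 * (L / 4)) = 2 * (1 - L) / (2 + L)" if "0 \<le> L" for L :: real
    proof -
      have "1 + 2 * (L / 4) \<noteq> 0" "2 + L \<noteq> 0" using that by linarith+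
      then show ?thesis by (simp add: field_simps)
    qed
    from this[of "lam\<^sup>2"] have "\<not> convex_of_order \<beta> (?q \<star> ?q)"
      using convex_order_quadratic_le[of "lam\<^sup>2 / 4" \<beta>] \<beta> unfolding qq by auto
    then show "\<not> (\<forall>f\<in>FH0 lam. \<forall>F\<in>FH0 lam. convex_of_order \<beta> (f \<star> F))" using q by blast
  }
qed

end
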